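(* The universal machine $\mathrm{IMP2}$ is additively optimal for the class of prefix machines. That is, for every prefix machine $G$ over the binary alphabet there is a constant $c$ (depending on $\mathrm{IMP2}$ and $G$ but not on $x$) such that for all binary strings $x$, \[ K_{\mathrm{IMP2}}(x) \le K_G(x) + c. \]
   Context: **Complexity and optimality.** A machine is a partial computable function from $\{0,1\}^*$ to $\{0,1\}^*$. A machine is a prefix machine if its domain (the set of programs on which it halts with an output) is prefix-free, i.e. no element of the domain is a proper prefix of another. For a machine $U$ and a binary string $x$, $K_U(x)=\min\{|p| : U(p)=x\}$, where $|p|$ is the length of $p$ in bits, with $K_U(x)=\infty$ if no such $p$ exists. A machine $U$ of a given class is additively optimal for that class if for every machine $U'$ of the same class there is a constant $c$, depending on $U$ and $U'$ but not on $x$, such that $K_U(x)\le K_{U'}(x)+c$ for all $x$. **Strings and numbers.** Let $\mathcal{B}_0,\mathcal{B}_1,\mathcal{B}_2,\dots$ be the length-increasing lexicographic enumeration of all binary strings: $\mathcal{B}_0=\epsilon$ (the empty string), $\mathcal{B}_1=0$, $\mathcal{B}_2=1$, $\mathcal{B}_3=00$, $\mathcal{B}_4=01$, and so on. For a natural number $n$ put $\bar n = 1^{|\mathcal{B}_n|}\cdot 0\cdot \mathcal{B}_n$ (concatenation), and for a binary string $y$ put $\langle n,y\rangle=\bar n\cdot y$. **Syntax of the IMP2 language.** Sentences are the strings generated from $P$ by the grammar - $P \to$ `skip` | `x[`$N$`] := `$A$ | `(while `$B$` do `$P$`)` | `(`$P$` ; `$P$`)` | `(if `$B$` then `$P$`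 else `$P$`)` - $B \to$ `true` | `false` | `(`$A$` = `$A$`)` | `(`$A$` < `$A$`)` | `(`$B$` and `$B$`)` | `(`$B$` or `$B$`)` | `not `$B$ - $A \to$ `readbit` | $N$ | `x[`$N$`]` | `(`$A$` + `$A$`)` | `(`$A$` - `$A$`)` | `(`$A$` * `$A$`)` where $N$ stands for decimal numerals of natural numbers (including $0$) without leading zeros. **Enumeration of sentences.** $n\mapsto P_n$ is a fixed bijection from the natural numbers to the set of IMP2 sentences (viewed as abstract syntax trees) such that both it and its inverse are computable. It is obtained by distributing positions alternately among the production rules of each syntactic category and by combining the positions of the components of a production with Cantor's pairing function (and a generalisation of it to tuples). **Semantics.** A sentence is executed with an array of memory locations `x[0]`, `x[1]`, `x[2]`, $\dots$, each holding an arbitrarily large non-negative integer and all initially $0$, and with a finite input stream $y\in\{0,1\}^*$. All commands and operators have their usual meaning: `skip` does nothing, `:=` is assignment, `;` is sequential composition, `while` and `if` are the usual control structures, `=`, `<`, `and`, `or`, `not` are the usual comparisons and Boolean operations, and `+`, `-`, `*` are addition, subtraction (truncated at $0$, since values are non-negative) and multiplication. Both operands of a binary operator are evaluated, left operand first. The arithmetic expression `readbit` reads the next unread bit of the input stream, starting with the first bit of $y$, and evaluates to that bit. Bits are read in order and never twice, and this is the only access to the input. If `readbit` is evaluated when no unread bit is left, the execution loops forever. There is no bound on the number of execution steps. **The machine IMP2.** On input $\langle n,y\rangle$, the machine IMP2 decodes $\bar n$, identifies $P_n$, and executes $P_n$ with input stream $y$ from the all-zero memory. (It is called universal because it can execute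 any sentence $P_n$ from its index.) If this execution halts having read exactly all the bits of $y$, then $\mathrm{IMP2}(\langle n,y\rangle)$ is defined and equals the concatenation $\mathcal{B}_{v_0}\cdot\mathcal{B}_{v_1}\cdot\mathcal{B}_{v_2}\cdots$, where $v_i$ is the final content of location `x[i]` (all but finitely many $v_i$ are $0$, contributing $\epsilon$). In all other cases (the execution does not halt, or it halts with unread bits of $y$ remaining, or the input is not of the form $\langle n,y\rangle$) the value of IMP2 is undefined. *)

theory Defs
  imports Main "HOL-Library.Extended_Nat" "HOL-Library.Sublist"
    "HOL-Library.Nat_Bijection" "HOL-Library.Monad_Syntax"
begin

section \<open>Binary strings\<close>

text \<open>The bits 0 and 1 are \<^const>\<open>False\<close> and \<^const>\<open>True\<close>.\<close>

type_synonym bitstring = "bool list"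

text \<open>
  The length-increasing lexicographic enumeration of all strings: the string with index \<open>n\<close> is the
  binary expansion of \<open>n + 1\<close> without its leading 1. The lemmas \<open>bij_bstr\<close> and \<open>bstr_less\<close> below
  characterise it.
\<close>

fun bstr :: "nat \<Rightarrow> bitstring" where
  "bstr 0 = []"
| "bstr (Suc n) = bstr (n div 2) @ [odd n]"

lemma bstr_snoc_eq_iff: "bstr n = u @ [b] \<longleftrightarrow> (\<exists>m. n = Suc (2 * m + of_bool b) \<and> bstr m = u)"
proof
  assume "bstr n = u @ [b]"
  then obtain k where k: "n = Suc k" "bstr (k div 2) = u" "odd k = b"
    by (cases n) auto
  then have "n = Suc (2 * (k div 2) + of_bool b)"
    by (cases b) auto
  with k(2) show "\<exists>m. n = Suc (2 * m + of_bool b) \<and> bstr m = u" by blast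
qed (cases b; auto)

lemma bstr_eq_Nil_iff [simp]: "bstr n = [] \<longleftrightarrow> n = 0"
  by (cases n) auto

lemma inj_bstr: "inj bstr"
proof (rule injI)
  show "bstr m = bstr n \<Longrightarrow> m = n" for m n
  proof (induction m arbitrary: n rule: bstr.induct)
    case 1
    then show ?case by (metis bstr.simps(1) bstr_eq_Nil_iff)
  next
    case (2 m)
    from "2.prems" have "bstr n = bstr (m div 2) @ [odd m]" by simp
    then obtain k where k: "n = Suc (2 * k + of_bool (odd m))" "bstr (m div 2) = bstr k"
      unfolding bstr_snoc_eq_iff by auto
    from "2.IH"[OF k(2)] have "k = m div 2" by simp
    with k(1) show ?case by (cases "odd m") auto
  qed
qed

lemma surj_bstr: "surj bstr"
proof -
  have "\<exists>n. bstr n = w" for w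
  proof (induction w rule: rev_induct)
    case Nil
    then show ?case by simp
  next
    case (snoc b u)
    then show ?case unfolding bstr_snoc_eq_iff by blast
  qed
  then show ?thesis unfolding surj_def by metis
qed

lemma bij_bstr: "bij bstr"
  using inj_bstr surj_bstr by (simp add: bij_def)

lemma bstr_less: "m < n \<Longrightarrow> (bstr m, bstr n) \<in> lenlex {(False, True)}"
proof (induction m arbitrary: n rule: bstr.induct)
  case 1
  then show ?case by (cases n) (auto simp: lenlex_conv)
next
  case (2 m)
  then obtain k where n: "n = Suc k" and "m < k" by (cases n) auto
  then have "m div 2 < k div 2 \<or> m div 2 = k div 2 \<and> even m \<and> odd k" by presburger
  then show ?case
  proof
    assume "m div 2 < k div 2"
    from "2.IH"[OF this] show ?thesis unfolding n by (simp add: lenlex_append1)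
  next
    assume "m div 2 = k div 2 \<and> even m \<and> odd k"
    then show ?thesis
      unfolding n by (auto simp: lenlex_conv intro!: lex_append_leftI)
  qed
qed

definition selfdelim :: "nat \<Rightarrow> bitstring" where
  "selfdelim n = replicate (length (bstr n)) True @ [False] @ bstr n"

definition tuple :: "nat \<Rightarrow> bitstring \<Rightarrow> bitstring" where
  "tuple n y = selfdelim n @ y"

lemma selfdelim_prefix_inj:
  assumes "selfdelim m @ y = selfdelim n @ z"
  shows "m = n \<and> y = z"
proof -
  have run: "a = b \<and> u = v"
    if "replicate a True @ False # u = replicate b True @ False # v" for a b and u v :: bitstring
    using that
  proof (induction a arbitrary: b)
    case 0
    then show ?case by (cases b) auto
  next
    case (Suc a)
    then show ?case by (cases b) auto
  qed
  from assms have "replicate (length (bstr m)) True @ False # (bstr m @ y) =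
      replicate (length (bstr n)) True @ False # (bstr n @ z)"
    by (simp add: selfdelim_def)
  from run[OF this] have "bstr m = bstr n \<and> y = z"
    using append_eq_append_conv by blast
  then show ?thesis using inj_bstr by (auto dest: injD)
qed


section \<open>Partial computable functions\<close>

text \<open>
  Terms for the partial recursive functions on natural numbers. Arities are not recorded: on argument
  lists of any fixed length each term denotes a partial recursive function, which is nowhere defined
  if the term does not fit that length.
\<close>

datatype recf =
    Zero
  | Succ
  | Proj nat
  | Comp recf "recf list"
  | PrimRec recf recf
  | Minimize recf

inductive reval :: "recf \<Rightarrow> nat list \<Rightarrow> nat \<Rightarrow> bool" where
  "reval Zero xs 0"
| "reval Succ [x] (Suc x)"
| "i < length xs \<Longrightarrow> reval (Proj i) xs (xs ! i)"
| "list_all2 (\<lambda>g y. reval g xs y) gs ys \<Longrightarrow> reval f ys z \<Longrightarrow> reval (Comp f gs) xs z"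
| "reval f xs z \<Longrightarrow> reval (PrimRec f g) (0 # xs) z"
| "reval (PrimRec f g) (n # xs) y \<Longrightarrow> reval g (n # y # xs) z \<Longrightarrow>
   reval (PrimRec f g) (Suc n # xs) z"
| "reval f (n # xs) 0 \<Longrightarrow> (\<forall>m<n. \<exists>y. reval f (m # xs) (Suc y)) \<Longrightarrow> reval (Minimize f) xs n"

inductive_cases reval_elims:
  "reval Zero xs z" "reval Succ xs z" "reval (Proj i) xs z" "reval (Comp f gs) xs z"
  "reval (PrimRec f g) (0 # xs) z" "reval (PrimRec f g) (Suc n # xs) z"
  "reval (Minimize f) xs z"

lemma reval_deterministic: "reval f xs y \<Longrightarrow> reval f xs z \<Longrightarrow> y = z"
proof (induction arbitrary: z rule: reval.induct)
  case (1 xs)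
  then show ?case by (auto elim: reval_elims(1))
next
  case (2 x)
  then show ?case by (auto elim: reval_elims(2))
next
  case (3 i xs)
  from "3.prems" show ?case by (auto elim: reval_elims(3))
next
  case (4 xs gs ys f y)
  from "4.prems" obtain zs where zs: "list_all2 (\<lambda>g y. reval g xs y) gs zs" "reval f zs z"
    by (auto elim: reval_elims(4))
  have "ys = zs"
    using "4.IH"(1) zs(1) by (auto simp: list_all2_conv_all_nth intro!: nth_equalityI)
  with zs(2) "4.IH"(2) show ?case by simp
next
  case (5 f xs y g)
  from "5.prems" "5.IH" show ?case by (auto elim: reval_elims(5))
next
  case (6 f g n xs y z')
  from "6.prems" obtain y' where "reval (PrimRec f g) (n # xs) y'" "reval g (n # y' # xs) z"
    by (auto elim: reval_elims(6))
  with "6.IH" show ?case by auto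
next
  case (7 f n xs)
  from "7.prems" have z: "reval f (z # xs) 0" "\<forall>m<z. \<exists>y. reval f (m # xs) (Suc y)"
    by (auto elim: reval_elims(7))
  show ?case
  proof (rule linorder_cases[of n z])
    assume "n < z"
    with z(2) "7.IH"(1) show ?thesis by (metis nat.distinct(1))
  next
    assume "z < n"
    with z(1) "7.IH"(2) show ?thesis by (metis nat.distinct(1))
  qed
qed


section \<open>Machines, complexity and additive optimality\<close>

type_synonym machine = "bitstring \<rightharpoonup> bitstring"

text \<open>Strings are identified with natural numbers by the enumeration \<^const>\<open>bstr\<close>.\<close>

definition partial_computable :: "machine \<Rightarrow> bool" where
  "partial_computable M \<longleftrightarrow> (\<exists>f. \<forall>m n. M (bstr m) = Some (bstr n) \<longleftrightarrow> reval f [m] n)"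

definition prefix_free :: "bitstring set \<Rightarrow> bool" where
  "prefix_free D \<longleftrightarrow> (\<forall>p\<in>D. \<forall>q\<in>D. \<not> strict_prefix p q)"

definition prefix_machine :: "machine \<Rightarrow> bool" where
  "prefix_machine M \<longleftrightarrow> partial_computable M \<and> prefix_free (dom M)"

text \<open>The infimum of the empty set is \<^term>\<open>\<infinity> :: enat\<close>; a nonempty infimum is attained.\<close>

definition complexity :: "machine \<Rightarrow> bitstring \<Rightarrow> enat" where
  "complexity U x = (INF p\<in>{p. U p = Some x}. enat (length p))"

definition additively_optimal :: "(machine \<Rightarrow> bool) \<Rightarrow> machine \<Rightarrow> bool" where
  "additively_optimal \<C> U \<longleftrightarrow>
     \<C> U \<and> (\<forall>U'. \<C> U' \<longrightarrow> (\<exists>c::nat. \<forall>x. complexity U x \<le> complexity U' x + enat c))"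


section \<open>Syntax of IMP2\<close>

datatype aexp =
    ReadBit
  | Num nat
  | Loc nat
  | Plus aexp aexp
  | Minus aexp aexp
  | Times aexp aexp

datatype bexp =
    TrueB
  | FalseB
  | Equal aexp aexp
  | Less aexp aexp
  | And bexp bexp
  | Or bexp bexp
  | Not bexp

datatype com =
    Skip
  | Assign nat aexp
  | While bexp com
  | Seq com com
  | If bexp com com


section \<open>Enumeration of sentences\<close>

text \<open>
  The position of a sentence. In each syntactic category the productions without components take one
  position each, at the start; the remaining positions are dealt out in turn to the other productions.
  Components are combined by Cantor's pairing function \<^const>\<open>prod_encode\<close>, nested for triples.
\<close>

primrec aexp_pos :: "aexp \<Rightarrow> nat" where
  "aexp_pos ReadBit = 0"
| "aexp_pos (Num n) = 5 * n + 1"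
| "aexp_pos (Loc n) = 5 * n + 2"
| "aexp_pos (Plus a b) = 5 * prod_encode (aexp_pos a, aexp_pos b) + 3"
| "aexp_pos (Minus a b) = 5 * prod_encode (aexp_pos a, aexp_pos b) + 4"
| "aexp_pos (Times a b) = 5 * prod_encode (aexp_pos a, aexp_pos b) + 5"

primrec bexp_pos :: "bexp \<Rightarrow> nat" where
  "bexp_pos TrueB = 0"
| "bexp_pos FalseB = 1"
| "bexp_pos (Equal a b) = 5 * prod_encode (aexp_pos a, aexp_pos b) + 2"
| "bexp_pos (Less a b) = 5 * prod_encode (aexp_pos a, aexp_pos b) + 3"
| "bexp_pos (And b c) = 5 * prod_encode (bexp_pos b, bexp_pos c) + 4"
| "bexp_pos (Or b c) = 5 * prod_encode (bexp_pos b, bexp_pos c) + 5"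
| "bexp_pos (Not b) = 5 * bexp_pos b + 6"

primrec com_pos :: "com \<Rightarrow> nat" where
  "com_pos Skip = 0"
| "com_pos (Assign i a) = 4 * prod_encode (i, aexp_pos a) + 1"
| "com_pos (While b p) = 4 * prod_encode (bexp_pos b, com_pos p) + 2"
| "com_pos (Seq p q) = 4 * prod_encode (com_pos p, com_pos q) + 3"
| "com_pos (If b p q) =
     4 * prod_encode (bexp_pos b, prod_encode (com_pos p, com_pos q)) + 4"

definition sentence :: "nat \<Rightarrow> com" where
  "sentence = inv com_pos"

lemma prod_encode_surj: "\<exists>i j. prod_encode (i, j) = n \<and> i \<le> n \<and> j \<le> n"
  by (metis prod_decode_inverse surj_pair le_prod_encode_1 le_prod_encode_2)

lemma aexp_pos_inj: "aexp_pos a = aexp_pos b \<Longrightarrow> a = b"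
proof (induction a arbitrary: b)
  case ReadBit
  then show ?case by (cases b) auto
next
  case (Num n)
  then show ?case by (cases b; simp; presburger)
next
  case (Loc n)
  then show ?case by (cases b; simp; presburger)
next
  case (Plus a1 a2)
  from Plus.prems show ?case
    by (cases b; simp; (presburger | auto dest: Plus.IH))
next
  case (Minus a1 a2)
  from Minus.prems show ?case
    by (cases b; simp; (presburger | auto dest: Minus.IH))
next
  case (Times a1 a2)
  from Times.prems show ?case
    by (cases b; simp; (presburger | auto dest: Times.IH))
qed

lemma aexp_pos_surj: "\<exists>a. aexp_pos a = n"
proof (induction n rule: less_induct)
  case (less n)
  have "n = 0 \<or> (\<exists>k. n = 5 * k + 1) \<or> (\<exists>k. n = 5 * k + 2) \<or> (\<exists>k. n = 5 * k + 3) \<or>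
      (\<exists>k. n = 5 * k + 4) \<or> (\<exists>k. n = 5 * k + 5)"
    by presburger
  then consider "n = 0" | k where "n = 5 * k + 1" | k where "n = 5 * k + 2" | k where "n = 5 * k + 3"
    | k where "n = 5 * k + 4" | k where "n = 5 * k + 5"
    by blast
  then show ?case
  proof cases
    case 1
    then show ?thesis by (metis aexp_pos.simps(1))
  next
    case (2 k)
    then show ?thesis by (metis aexp_pos.simps(2))
  next
    case (3 k)
    then show ?thesis by (metis aexp_pos.simps(3))
  next
    case (4 k)
    obtain i j where ij: "prod_encode (i, j) = k" "i \<le> k" "j \<le> k"
      using prod_encode_surj by blast
    with 4 have "i < n" "j < n" by auto
    with less.IH ij(1) 4 show ?thesis by (metis aexp_pos.simps(4))
  next
    case (5 k)
    obtain i j where ij: "prod_encode (i, j) = k" "i \<le> k" "j \<le> k"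
      using prod_encode_surj by blast
    with 5 have "i < n" "j < n" by auto
    with less.IH ij(1) 5 show ?thesis by (metis aexp_pos.simps(5))
  next
    case (6 k)
    obtain i j where ij: "prod_encode (i, j) = k" "i \<le> k" "j \<le> k"
      using prod_encode_surj by blast
    with 6 have "i < n" "j < n" by auto
    with less.IH ij(1) 6 show ?thesis by (metis aexp_pos.simps(6))
  qed
qed

lemma bexp_pos_inj: "bexp_pos b = bexp_pos c \<Longrightarrow> b = c"
proof (induction b arbitrary: c)
  case TrueB
  then show ?case by (cases c) auto
next
  case FalseB
  then show ?case by (cases c) auto
next
  case (Equal a1 a2)
  then show ?case by (cases c; simp; (presburger | auto dest: aexp_pos_inj))
next
  case (Less a1 a2)
  then show ?case by (cases c; simp; (presburger | auto dest: aexp_pos_inj))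
next
  case (And b1 b2)
  from And.prems show ?case
    by (cases c; simp; (presburger | auto dest: And.IH))
next
  case (Or b1 b2)
  from Or.prems show ?case
    by (cases c; simp; (presburger | auto dest: Or.IH))
next
  case (Not b)
  from Not.prems show ?case
    by (cases c; simp; (presburger | auto dest: Not.IH))
qed

lemma bexp_pos_surj: "\<exists>b. bexp_pos b = n"
proof (induction n rule: less_induct)
  case (less n)
  have "n = 0 \<or> n = 1 \<or> (\<exists>k. n = 5 * k + 2) \<or> (\<exists>k. n = 5 * k + 3) \<or>
      (\<exists>k. n = 5 * k + 4) \<or> (\<exists>k. n = 5 * k + 5) \<or> (\<exists>k. n = 5 * k + 6)"
    by presburger
  then consider "n = 0" | "n = 1" | k where "n = 5 * k + 2" | k where "n = 5 * k + 3"
    | k where "n = 5 * k + 4" | k where "n = 5 * k + 5" | k where "n = 5 * k + 6"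
    by blast
  then show ?case
  proof cases
    case 1
    then show ?thesis by (metis bexp_pos.simps(1))
  next
    case 2
    then show ?thesis by (metis bexp_pos.simps(2))
  next
    case (3 k)
    then show ?thesis by (metis bexp_pos.simps(3) prod_encode_surj aexp_pos_surj)
  next
    case (4 k)
    then show ?thesis by (metis bexp_pos.simps(4) prod_encode_surj aexp_pos_surj)
  next
    case (5 k)
    obtain i j where ij: "prod_encode (i, j) = k" "i \<le> k" "j \<le> k"
      using prod_encode_surj by blast
    with 5 have "i < n" "j < n" by auto
    with less.IH ij(1) 5 show ?thesis by (metis bexp_pos.simps(5))
  next
    case (6 k)
    obtain i j where ij: "prod_encode (i, j) = k" "i \<le> k" "j \<le> k"
      using prod_encode_surj by blast
    with 6 have "i < n" "j < n" by auto
    with less.IH ij(1) 6 show ?thesis by (metis bexp_pos.simps(6))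
  next
    case (7 k)
    then have "k < n" by simp
    with less.IH 7 show ?thesis by (metis bexp_pos.simps(7))
  qed
qed

lemma com_pos_inj: "com_pos p = com_pos q \<Longrightarrow> p = q"
proof (induction p arbitrary: q)
  case Skip
  then show ?case by (cases q) auto
next
  case (Assign i a)
  then show ?case by (cases q; simp; (presburger | auto dest: aexp_pos_inj))
next
  case (While b p)
  from While.prems show ?case
    by (cases q; simp; (presburger | auto dest: bexp_pos_inj While.IH))
next
  case (Seq p1 p2)
  from Seq.prems show ?case
    by (cases q; simp; (presburger | auto dest: Seq.IH))
next
  case (If b p1 p2)
  from If.prems show ?case
    by (cases q; simp; (presburger | auto dest: bexp_pos_inj If.IH))
qed

lemma com_pos_surj: "\<exists>p. com_pos p = n"
proof (induction n rule: less_induct)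
  case (less n)
  have "n = 0 \<or> (\<exists>k. n = 4 * k + 1) \<or> (\<exists>k. n = 4 * k + 2) \<or> (\<exists>k. n = 4 * k + 3) \<or>
      (\<exists>k. n = 4 * k + 4)"
    by presburger
  then consider "n = 0" | k where "n = 4 * k + 1" | k where "n = 4 * k + 2" | k where "n = 4 * k + 3"
    | k where "n = 4 * k + 4"
    by blast
  then show ?case
  proof cases
    case 1
    then show ?thesis by (metis com_pos.simps(1))
  next
    case (2 k)
    then show ?thesis by (metis com_pos.simps(2) prod_encode_surj aexp_pos_surj)
  next
    case (3 k)
    obtain i j where ij: "prod_encode (i, j) = k" "i \<le> k" "j \<le> k"
      using prod_encode_surj by blast
    with 3 have "j < n" by auto
    with less.IH ij(1) 3 show ?thesis by (metis com_pos.simps(3) bexp_pos_surj)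
  next
    case (4 k)
    obtain i j where ij: "prod_encode (i, j) = k" "i \<le> k" "j \<le> k"
      using prod_encode_surj by blast
    with 4 have "i < n" "j < n" by auto
    with less.IH ij(1) 4 show ?thesis by (metis com_pos.simps(4))
  next
    case (5 k)
    obtain i j where ij: "prod_encode (i, j) = k" "i \<le> k" "j \<le> k"
      using prod_encode_surj by blast
    obtain l m where lm: "prod_encode (l, m) = j" "l \<le> j" "m \<le> j"
      using prod_encode_surj by blast
    from 5 ij lm have "l < n" "m < n" by auto
    with less.IH ij(1) lm(1) 5 show ?thesis by (metis com_pos.simps(5) bexp_pos_surj)
  qed
qed

lemma bij_com_pos: "bij com_pos"
  unfolding bij_def surj_def by (metis injI com_pos_inj com_pos_surj)

lemma bij_sentence: "bij sentence"
  unfolding sentence_def using bij_com_pos by (rule bij_imp_bij_inv)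


section \<open>Semantics of IMP2\<close>

text \<open>
  Evaluation takes the memory and the unread input to the value and the input left unread. The value
  \<^const>\<open>None\<close> stands for the nontermination of \<^const>\<open>ReadBit\<close> on exhausted input.
  Conjunction and disjunction always evaluate both operands (no short circuit).
\<close>

type_synonym mem = "nat \<Rightarrow> nat"

primrec aval :: "aexp \<Rightarrow> mem \<Rightarrow> bitstring \<Rightarrow> (nat \<times> bitstring) option" where
  "aval ReadBit s y = (case y of [] \<Rightarrow> None | b # y' \<Rightarrow> Some (of_bool b, y'))"
| "aval (Num n) s y = Some (n, y)"
| "aval (Loc i) s y = Some (s i, y)"
| "aval (Plus a b) s y =
     do {(m, y) \<leftarrow> aval a s y; (n, y) \<leftarrow> aval b s y; Some (m + n, y)}"
| "aval (Minus a b) s y =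
     do {(m, y) \<leftarrow> aval a s y; (n, y) \<leftarrow> aval b s y; Some (m - n, y)}"
| "aval (Times a b) s y =
     do {(m, y) \<leftarrow> aval a s y; (n, y) \<leftarrow> aval b s y; Some (m * n, y)}"

primrec bval :: "bexp \<Rightarrow> mem \<Rightarrow> bitstring \<Rightarrow> (bool \<times> bitstring) option" where
  "bval TrueB s y = Some (True, y)"
| "bval FalseB s y = Some (False, y)"
| "bval (Equal a b) s y =
     do {(m, y) \<leftarrow> aval a s y; (n, y) \<leftarrow> aval b s y; Some (m = n, y)}"
| "bval (Less a b) s y =
     do {(m, y) \<leftarrow> aval a s y; (n, y) \<leftarrow> aval b s y; Some (m < n, y)}"
| "bval (And b c) s y =
     do {(u, y) \<leftarrow> bval b s y; (v, y) \<leftarrow> bval c s y; Some (u \<and> v, y)}"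
| "bval (Or b c) s y =
     do {(u, y) \<leftarrow> bval b s y; (v, y) \<leftarrow> bval c s y; Some (u \<or> v, y)}"
| "bval (Not b) s y = do {(u, y) \<leftarrow> bval b s y; Some (\<not> u, y)}"

text \<open>
  \<open>exec P (s, y) (s', y')\<close>: started in memory \<open>s\<close> with unread input \<open>y\<close>, \<open>P\<close> halts in memory \<open>s'\<close>
  with unread input \<open>y'\<close>.
\<close>

inductive exec :: "com \<Rightarrow> mem \<times> bitstring \<Rightarrow> mem \<times> bitstring \<Rightarrow> bool" where
  Skip: "exec Skip \<sigma> \<sigma>"
| Assign: "aval a s y = Some (n, y') \<Longrightarrow> exec (Assign i a) (s, y) (s(i := n), y')"
| WhileFalse: "bval b s y = Some (False, y') \<Longrightarrow> exec (While b p) (s, y) (s, y')"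
| WhileTrue: "bval b s y = Some (True, y') \<Longrightarrow> exec p (s, y') \<sigma> \<Longrightarrow> exec (While b p) \<sigma> \<tau> \<Longrightarrow>
    exec (While b p) (s, y) \<tau>"
| Seq: "exec p \<sigma> \<tau> \<Longrightarrow> exec q \<tau> \<upsilon> \<Longrightarrow> exec (Seq p q) \<sigma> \<upsilon>"
| IfTrue: "bval b s y = Some (True, y') \<Longrightarrow> exec p (s, y') \<tau> \<Longrightarrow> exec (If b p q) (s, y) \<tau>"
| IfFalse: "bval b s y = Some (False, y') \<Longrightarrow> exec q (s, y') \<tau> \<Longrightarrow> exec (If b p q) (s, y) \<tau>"

inductive_cases exec_elims:
  "exec Skip \<sigma> \<tau>" "exec (Assign i a) \<sigma> \<tau>" "exec (Seq p q) \<sigma> \<tau>"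
  "exec (If b p q) \<sigma> \<tau>" "exec (While b p) \<sigma> \<tau>"

lemma exec_deterministic: "exec p \<sigma> \<tau> \<Longrightarrow> exec p \<sigma> \<tau>' \<Longrightarrow> \<tau> = \<tau>'"
proof (induction arbitrary: \<tau>' rule: exec.induct)
  case (Skip \<sigma>)
  then show ?case by (auto elim: exec_elims(1))
next
  case (Assign a s y n y' i)
  from Assign.prems Assign.hyps show ?case by (auto elim: exec_elims(2))
next
  case (WhileFalse b s y y' p)
  from WhileFalse.prems WhileFalse.hyps show ?case by (cases rule: exec_elims(5)) auto
next
  case (WhileTrue b s y y' p \<sigma> \<tau>)
  from WhileTrue.prems WhileTrue.hyps(1)
  obtain \<sigma>' where "exec p (s, y') \<sigma>'" "exec (While b p) \<sigma>' \<tau>'"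
    by (cases rule: exec_elims(5)) auto
  with WhileTrue.IH show ?case by blast
next
  case (Seq p \<sigma> \<tau> q \<upsilon>)
  then show ?case by (metis exec_elims(3))
next
  case (IfTrue b s y y' p \<tau> q)
  from IfTrue.prems IfTrue.hyps(1) have "exec p (s, y') \<tau>'"
    by (cases rule: exec_elims(4)) auto
  with IfTrue.IH show ?case by blast
next
  case (IfFalse b s y y' q \<tau> p)
  from IfFalse.prems IfFalse.hyps(1) have "exec q (s, y') \<tau>'"
    by (cases rule: exec_elims(4)) auto
  with IfFalse.IH show ?case by blast
qed


section \<open>The machine IMP2\<close>

text \<open>
  Final memories have finite support, so the infinite concatenation of the strings
  \<^term>\<open>bstr (s i)\<close> may be cut off where only zeros (contributing the empty string) follow.
\<close>

definition out :: "mem \<Rightarrow> bitstring" where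
  "out s = concat (map (\<lambda>i. bstr (s i)) [0..<(LEAST m. \<forall>i\<ge>m. s i = 0)])"

lemma out_eq:
  assumes "\<forall>i\<ge>m. s i = 0"
  shows "out s = concat (map (\<lambda>i. bstr (s i)) [0..<m])"
proof -
  define l where "l = (LEAST m. \<forall>i\<ge>m. s i = 0)"
  have "l \<le> m" and "\<forall>i\<ge>l. s i = 0"
    unfolding l_def using assms by (rule Least_le, rule LeastI)
  then have "[0..<m] = [0..<l] @ [l..<m]" "concat (map (\<lambda>i. bstr (s i)) [l..<m]) = []"
    by (auto simp: upt_add_eq_append[symmetric] le_iff_add)
  then show ?thesis unfolding out_def l_def[symmetric] by simp
qed

lemma exec_finite_support:
  "exec p \<sigma> \<tau> \<Longrightarrow> finite {i. fst \<sigma> i \<noteq> 0} \<Longrightarrow> finite {i. fst \<tau> i \<noteq> 0}"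
proof (induction rule: exec.induct)
  case (Assign a s y n y' i)
  have "{j. (s(i := n)) j \<noteq> 0} \<subseteq> insert i {j. s j \<noteq> 0}" by auto
  moreover have "finite (insert i {j. s j \<noteq> 0})"
    using Assign.prems by simp
  ultimately have "finite {j. (s(i := n)) j \<noteq> 0}"
    by (rule finite_subset)
  then show ?case by (simp only: fst_conv)
qed auto

definition imp2_result :: "bitstring \<Rightarrow> bitstring \<Rightarrow> bool" where
  "imp2_result w x \<longleftrightarrow>
     (\<exists>n y s. w = tuple n y \<and> exec (sentence n) (\<lambda>_. 0, y) (s, []) \<and> x = out s)"

definition IMP2 :: machine where
  "IMP2 w = (if \<exists>x. imp2_result w x then Some (THE x. imp2_result w x) else None)"

lemma imp2_result_unique: "imp2_result w x \<Longrightarrow> imp2_result w x' \<Longrightarrow> x = x'"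
  unfolding imp2_result_def tuple_def
  by (metis selfdelim_prefix_inj exec_deterministic prod.inject)

lemma IMP2_eq_Some_iff: "IMP2 w = Some x \<longleftrightarrow> imp2_result w x"
  unfolding IMP2_def by (auto intro: theI imp2_result_unique)

end

theory Submission
  imports Defs
begin

text \<open>
  A program for a given prefix machine \<open>G\<close> reads its input bit by bit. Having read \<open>w\<close>, it searches
  for some program \<open>p\<close> in the domain of \<open>G\<close> that extends \<open>w\<close>. As the domain is prefix-free, \<open>p = w\<close>
  means that the input ends here and \<open>G w\<close> is the output; otherwise \<open>w\<close> is not in the domain and
  reading another bit is safe. The search is a recursive function, and recursive functions compile
  to IMP2.

  That IMP2 is itself computable and that the search is recursive both follow from one principle:
  a predicate inductively defined by a semidecidable set of finitary rules is semidecidable, since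
  one can search for a list of judgements each of which follows from later ones. Thus neither a
  universal machine nor a step-bounded interpreter has to be programmed as a recursive function.
\<close>

section \<open>Primitive recursive arithmetic\<close>

text \<open>The simulation must decide before each \<open>readbit\<close>, because reading is
  irrevocable and reading past the end diverges. The domain of a machine is in general undecidable,
  so the decision is a search, guaranteed to end only while the bits read so far begin some program
  of \<open>G\<close>. The program found may differ from the one on the input. The search is
  therefore specified as a relation, of which a recursive function picks some related value;
  prefix-freeness makes every pick lead to the same decision.

  One direction of the simulation is enough: if \<open>G p = Some x\<close>, then
  \<open>IMP2 (tuple n p) = Some x\<close>. Whatever \<open>IMP2\<close> does on other inputs can
  only lower its complexities, so the compiler is verified for halting computations alone. The
  constant is \<open>length (selfdelim n)\<close>, where \<open>n\<close> is the index of the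
  simulating sentence. As \<open>out\<close> collects all memory locations, that sentence must
  finally erase its scratch space and keep only the result in location 0.\<close>

lemma reval_Proj: "i < length xs \<Longrightarrow> y = xs ! i \<Longrightarrow> reval (Proj i) xs y"
  by (simp add: reval.intros(3))

lemma reval_Comp1: "reval g xs y \<Longrightarrow> reval f [y] z \<Longrightarrow> reval (Comp f [g]) xs z"
  by (rule reval.intros(4)[of xs _ "[y]"]) simp_all

lemma reval_Comp2:
  "reval g xs y \<Longrightarrow> reval h xs z \<Longrightarrow> reval f [y, z] u \<Longrightarrow> reval (Comp f [g, h]) xs u"
  by (rule reval.intros(4)[of xs _ "[y, z]"]) simp_all

lemma reval_PrimRec:
  assumes "reval f xs (F 0)" "\<And>n. reval g (n # F n # xs) (F (Suc n))"
  shows "reval (PrimRec f g) (n # xs) (F n)"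
  by (induction n) (auto intro: reval.intros assms)

lemma reval_add: "\<exists>f. \<forall>x y. reval f [x, y] (x + y)"
proof -
  have "reval (PrimRec (Proj 0) (Comp Succ [Proj 1])) [x, y] (x + y)" for x y
    by (rule reval_PrimRec[where F = "\<lambda>x. x + y"])
      (auto intro!: reval_Comp1 reval_Proj reval.intros(2))
  then show ?thesis by blast
qed

lemma reval_mult: "\<exists>f. \<forall>x y. reval f [x, y] (x * y)"
proof -
  obtain a where a: "\<And>x y. reval a [x, y] (x + y)"
    using reval_add by blast
  have "reval (PrimRec Zero (Comp a [Proj 2, Proj 1])) [x, y] (x * y)" for x y
  proof (rule reval_PrimRec[where F = "\<lambda>x. x * y"])
    show "reval Zero [y] (0 * y)"
      by (simp add: reval.intros(1))
    show "reval (Comp a [Proj 2, Proj 1]) [n, n * y, y] (Suc n * y)" for n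
      using a[of y "n * y"] by (auto intro!: reval_Comp2 reval_Proj)
  qed
  then show ?thesis by blast
qed

text \<open>Iterated predecessor. Primitive recursion runs on the first argument, so the subtrahend
  has to come first; the outer \<open>Comp\<close> restores the order.\<close>

lemma reval_minus: "\<exists>f. \<forall>x y. reval f [x, y] (x - y)"
proof -
  have pred: "reval (PrimRec Zero (Proj 0)) [x] (x - 1)" for x
    by (rule reval_PrimRec[where F = "\<lambda>x. x - 1"])
      (auto intro!: reval_Proj reval.intros(1))
  have "reval (PrimRec (Proj 0) (Comp (PrimRec Zero (Proj 0)) [Proj 1])) [y, x] (x - y)" for x y
  proof (rule reval_PrimRec[where F = "\<lambda>y. x - y"])
    show "reval (Proj 0) [x] (x - 0)"
      by (simp add: reval_Proj)
    show "reval (Comp (PrimRec Zero (Proj 0)) [Proj 1]) [n, x - n, x] (x - Suc n)" for n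
      using pred[of "x - n"] by (auto intro!: reval_Comp1 reval_Proj)
  qed
  then have "reval (Comp (PrimRec (Proj 0) (Comp (PrimRec Zero (Proj 0)) [Proj 1])) [Proj 1, Proj 0])
      [x, y] (x - y)" for x y
    by (rule reval_Comp2[rotated 2]) (simp_all add: reval_Proj)
  then show ?thesis by blast
qed

lemma reval_triangle: "\<exists>f. \<forall>x. reval f [x] (triangle x)"
proof -
  obtain a where a: "\<And>x y. reval a [x, y] (x + y)"
    using reval_add by blast
  have "reval (PrimRec Zero (Comp a [Proj 1, Comp Succ [Proj 0]])) [x] (triangle x)" for x
  proof (rule reval_PrimRec[where F = triangle])
    show "reval Zero [] (triangle 0)"
      by (simp add: reval.intros(1))
    show "reval (Comp a [Proj 1, Comp Succ [Proj 0]]) [n, triangle n] (triangle (Suc n))" for n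
      using a[of "triangle n" "Suc n"]
      by (auto intro!: reval_Comp2 reval_Comp1 reval_Proj reval.intros(2))
  qed
  then show ?thesis by blast
qed

lemma reval_prod_encode: "\<exists>f. \<forall>m n. reval f [m, n] (prod_encode (m, n))"
proof -
  obtain a where a: "\<And>x y. reval a [x, y] (x + y)"
    using reval_add by blast
  obtain t where t: "\<And>x. reval t [x] (triangle x)"
    using reval_triangle by blast
  have "reval (Comp a [Comp t [Comp a [Proj 0, Proj 1]], Proj 0]) [m, n] (triangle (m + n) + m)" for m n
    by (intro reval_Comp2[OF _ _ a] reval_Comp1[OF _ t] reval_Proj) simp_all
  then show ?thesis unfolding prod_encode_def by auto
qed

lemma triangle_mono: "m \<le> n \<Longrightarrow> triangle m \<le> triangle n"
  by (rule lift_Suc_mono_le[of triangle]) simp_all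

text \<open>Inverting Cantor's pairing amounts to finding the diagonal: \<open>m + n\<close> is the
  least \<open>s\<close> for which \<open>triangle (Suc s)\<close> exceeds the code. Both components
  then follow by subtraction.\<close>

lemma reval_pair_sum: "\<exists>f. \<forall>m n. reval f [prod_encode (m, n)] (m + n)"
proof -
  obtain t where t: "\<And>x. reval t [x] (triangle x)"
    using reval_triangle by blast
  obtain d where d: "\<And>x y. reval d [x, y] (x - y)"
    using reval_minus by blast
  define g where "g = Comp d [Comp Succ [Proj 1], Comp t [Comp Succ [Proj 0]]]"
  have g: "reval g [s, z] (Suc z - triangle (Suc s))" for s z
    unfolding g_def
  proof (rule reval_Comp2[OF _ _ d])
    show "reval (Comp Succ [Proj 1]) [s, z] (Suc z)"
      by (rule reval_Comp1[OF _ reval.intros(2)]) (simp add: reval_Proj)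
    show "reval (Comp t [Comp Succ [Proj 0]]) [s, z] (triangle (Suc s))"
      by (rule reval_Comp1[OF reval_Comp1[OF _ reval.intros(2)] t]) (simp add: reval_Proj)
  qed
  have "reval (Minimize g) [prod_encode (m, n)] (m + n)" for m n
  proof (rule reval.intros(7))
    show "reval g [m + n, prod_encode (m, n)] 0"
      using g[of "m + n" "prod_encode (m, n)"] by (simp add: prod_encode_def)
    have "\<exists>y. reval g [s, prod_encode (m, n)] (Suc y)" if "s < m + n" for s
    proof -
      have "triangle (Suc s) \<le> triangle (m + n)"
        using that by (intro triangle_mono) simp
      then have "Suc (prod_encode (m, n)) - triangle (Suc s) = Suc (prod_encode (m, n) - triangle (Suc s))"
        by (simp add: prod_encode_def Suc_diff_le)
      then show ?thesis
        using g[of s "prod_encode (m, n)"] by auto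
    qed
    then show "\<forall>s<m + n. \<exists>y. reval g [s, prod_encode (m, n)] (Suc y)" by blast
  qed
  then show ?thesis by blast
qed


section \<open>Recursive, decidable and semidecidable over coded types\<close>

text \<open>Bijectivity makes \<open>enc\<close> and \<open>dec\<close> act as the identity on
  codes, hence recursive outright, and lets a search through all numbers range over exactly the
  objects of a type.\<close>

class code =
  fixes enc :: "'a \<Rightarrow> nat"
  assumes bij_enc: "bij enc"

definition dec :: "nat \<Rightarrow> 'a::code" where
  "dec = inv enc"

lemma enc_dec [simp]: "enc (dec n) = n"
  unfolding dec_def by (rule surj_f_inv_f[OF bij_is_surj[OF bij_enc]])

lemma dec_enc [simp]: "dec (enc x) = x"
  unfolding dec_def by (rule inv_f_f[OF bij_is_inj[OF bij_enc]])

lemma enc_eq_iff [simp]: "enc x = enc y \<longleftrightarrow> x = y"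
  by (metis dec_enc)

instantiation nat :: code
begin
definition enc_nat :: "nat \<Rightarrow> nat" where "enc_nat n = n"
instance by standard (simp add: enc_nat_def bij_def inj_def surj_def)
end

declare enc_nat_def [simp]

instantiation prod :: (code, code) code
begin
definition enc_prod :: "'a \<times> 'b \<Rightarrow> nat" where
  "enc_prod p = prod_encode (enc (fst p), enc (snd p))"
instance
proof
  show "bij (enc :: 'a \<times> 'b \<Rightarrow> nat)"
  proof (rule o_bij)
    show "(\<lambda>n. (dec (fst (prod_decode n)), dec (snd (prod_decode n)))) \<circ> enc = (id :: 'a \<times> 'b \<Rightarrow> _)"
      by (simp add: fun_eq_iff enc_prod_def)
    show "(enc :: 'a \<times> 'b \<Rightarrow> nat) \<circ> (\<lambda>n. (dec (fst (prod_decode n)), dec (snd (prod_decode n)))) = id"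
      by (simp add: fun_eq_iff enc_prod_def)
  qed
qed
end

instantiation list :: (code) code
begin
definition enc_list :: "'a list \<Rightarrow> nat" where
  "enc_list xs = list_encode (map enc xs)"
instance
proof
  show "bij (enc :: 'a list \<Rightarrow> nat)"
  proof (rule o_bij)
    show "(\<lambda>n. map dec (list_decode n)) \<circ> enc = (id :: 'a list \<Rightarrow> _)"
      by (simp add: fun_eq_iff enc_list_def comp_def)
    show "(enc :: 'a list \<Rightarrow> nat) \<circ> (\<lambda>n. map dec (list_decode n)) = id"
      by (simp add: fun_eq_iff enc_list_def comp_def)
  qed
qed
end

text \<open>Positions in the enumeration serve as codes. For \<open>com\<close> this makes
  \<open>sentence\<close> the decoding function \<open>dec\<close>, so passing from an index to its
  sentence is the identity on codes.\<close>

instantiation aexp :: code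
begin
definition enc_aexp :: "aexp \<Rightarrow> nat" where "enc_aexp = aexp_pos"
instance by standard (metis aexp_pos_inj aexp_pos_surj bij_def enc_aexp_def injI surj_def)
end

instantiation bexp :: code
begin
definition enc_bexp :: "bexp \<Rightarrow> nat" where "enc_bexp = bexp_pos"
instance by standard (metis bexp_pos_inj bexp_pos_surj bij_def enc_bexp_def injI surj_def)
end

instantiation com :: code
begin
definition enc_com :: "com \<Rightarrow> nat" where "enc_com = com_pos"
instance by standard (simp add: enc_com_def bij_com_pos)
end

lemma enc_Nil [simp]: "enc [] = 0"
  by (simp add: enc_list_def)

lemma enc_Cons: "enc (x # xs) = Suc (prod_encode (enc x, enc xs))"
  by (simp add: enc_list_def)

text \<open>\<open>enc\<close> is recursive at once, so it can serve as the bound when quantifying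
  over the positions of a list.\<close>

lemma length_le_enc: "length xs \<le> enc xs"
  by (induction xs) (auto simp: enc_Cons intro: le_trans[OF _ le_prod_encode_2])


section \<open>Closure properties of recursive functions and decidable predicates\<close>

definition recursive :: "('a::code \<Rightarrow> 'b::code) \<Rightarrow> bool" where
  "recursive F \<longleftrightarrow> (\<exists>f. \<forall>x. reval f [enc x] (enc (F x)))"

definition decidable :: "('a::code \<Rightarrow> bool) \<Rightarrow> bool" where
  "decidable P \<longleftrightarrow> recursive (\<lambda>x. of_bool (P x) :: nat)"

named_theorems recursive_intros

text \<open>Only codes matter: a function into any coded type is recursive as soon as some recursive
  function, possibly of another result type, yields the same codes.\<close>

lemma recursive_enc_eq:
  "recursive N \<Longrightarrow> (\<And>x. enc (F x) = enc (N x)) \<Longrightarrow> recursive F"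
  unfolding recursive_def by simp

lemma recursive_comp: "recursive F \<Longrightarrow> recursive G \<Longrightarrow> recursive (\<lambda>x. F (G x))"
  unfolding recursive_def by (blast intro: reval_Comp1)

lemma recursive_id [recursive_intros]: "recursive (\<lambda>x. x)"
  unfolding recursive_def by (rule exI[of _ "Proj 0"]) (simp add: reval_Proj)

lemma reval_const: "\<exists>f. \<forall>xs. reval f xs n"
proof (induction n)
  case 0
  show ?case by (blast intro: reval.intros(1))
next
  case (Suc n)
  then obtain f where "\<And>xs. reval f xs n" by blast
  then have "reval (Comp Succ [f]) xs (Suc n)" for xs
    by (rule reval_Comp1[OF _ reval.intros(2)])
  then show ?case by blast
qed

lemma recursive_const [recursive_intros]: "recursive (\<lambda>x. c)"
  unfolding recursive_def using reval_const by blast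

lemma recursive_binary:
  fixes B :: "nat \<Rightarrow> nat \<Rightarrow> nat"
  assumes "\<exists>f. \<forall>x y. reval f [x, y] (B x y)" "recursive F" "recursive G"
  shows "recursive (\<lambda>x. B (F x) (G x))"
proof -
  obtain b f g where "\<And>x y. reval b [x, y] (B x y)" "\<And>x. reval f [enc x] (F x)" "\<And>x. reval g [enc x] (G x)"
    using assms unfolding recursive_def by auto
  then have "reval (Comp b [f, g]) [enc x] (B (F x) (G x))" for x
    by (blast intro: reval_Comp2)
  then show ?thesis
    unfolding recursive_def by auto
qed

lemmas recursive_add [recursive_intros] = recursive_binary[OF reval_add]
  and recursive_mult [recursive_intros] = recursive_binary[OF reval_mult]
  and recursive_minus [recursive_intros] = recursive_binary[OF reval_minus]

lemma recursive_Suc [recursive_intros]: "recursive F \<Longrightarrow> recursive (\<lambda>x. Suc (F x))"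
  using recursive_add[OF recursive_const[of 1]] by simp

lemma recursive_enc [recursive_intros]: "recursive F \<Longrightarrow> recursive (\<lambda>x. enc (F x))"
  by (erule recursive_enc_eq) simp

lemma recursive_dec [recursive_intros]: "recursive F \<Longrightarrow> recursive (\<lambda>x. dec (F x))"
  by (erule recursive_enc_eq) simp

lemma recursive_triangle [recursive_intros]: "recursive F \<Longrightarrow> recursive (\<lambda>x. triangle (F x))"
  by (erule recursive_comp[rotated]) (use reval_triangle in \<open>simp add: recursive_def\<close>)

lemma recursive_Pair [recursive_intros]:
  assumes "recursive F" "recursive G"
  shows "recursive (\<lambda>x. (F x, G x))"
proof (rule recursive_enc_eq)
  show "recursive (\<lambda>x. triangle (enc (F x) + enc (G x)) + enc (F x))"
    by (intro recursive_intros assms)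
qed (simp add: enc_prod_def prod_encode_def)

lemma recursive_pair_sum: "recursive (\<lambda>p. enc (fst p) + enc (snd p))"
  using reval_pair_sum unfolding recursive_def by (auto simp: enc_prod_def)

lemma recursive_fst [recursive_intros]:
  assumes "recursive F"
  shows "recursive (\<lambda>x. fst (F x))"
proof (rule recursive_comp[OF _ assms], rule recursive_enc_eq)
  show "recursive (\<lambda>p :: 'b \<times> 'c. enc p - triangle (enc (fst p) + enc (snd p)))"
    by (intro recursive_intros recursive_pair_sum)
qed (simp add: enc_prod_def prod_encode_def)

lemma recursive_snd [recursive_intros]:
  assumes "recursive F"
  shows "recursive (\<lambda>x. snd (F x))"
proof (rule recursive_comp[OF _ assms], rule recursive_enc_eq)
  show "recursive (\<lambda>p :: 'b \<times> 'c. enc (fst p) + enc (snd p) - enc (fst p))"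
    by (intro recursive_intros recursive_pair_sum)
qed simp

lemma recursive_comp2:
  "recursive (\<lambda>z. F (fst z) (snd z)) \<Longrightarrow> recursive G \<Longrightarrow> recursive H \<Longrightarrow>
   recursive (\<lambda>x. F (G x) (H x))"
  using recursive_comp[OF _ recursive_Pair] by force

lemma decidable_eq [recursive_intros]:
  assumes "recursive F" "recursive G"
  shows "decidable (\<lambda>x. F x = G x)"
  unfolding decidable_def
proof (rule recursive_enc_eq)
  show "recursive (\<lambda>x. 1 - ((enc (F x) - enc (G x)) + (enc (G x) - enc (F x))))"
    by (intro recursive_intros assms)
  show "enc (of_bool (F x = G x) :: nat) =
      enc (1 - ((enc (F x) - enc (G x)) + (enc (G x) - enc (F x))))" for x
    unfolding enc_eq_iff[of "F x" "G x", symmetric] by (auto simp del: enc_eq_iff)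
qed

lemma decidable_conj [recursive_intros]:
  "decidable P \<Longrightarrow> decidable Q \<Longrightarrow> decidable (\<lambda>x. P x \<and> Q x)"
  unfolding decidable_def of_bool_conj by (rule recursive_mult)

lemma decidable_not [recursive_intros]: "decidable P \<Longrightarrow> decidable (\<lambda>x. \<not> P x)"
  unfolding decidable_def of_bool_not_iff
  by (rule recursive_enc_eq[OF recursive_minus[OF recursive_const[of 1]]]) auto

lemma decidable_disj [recursive_intros]:
  "decidable P \<Longrightarrow> decidable Q \<Longrightarrow> decidable (\<lambda>x. P x \<or> Q x)"
  using decidable_not[OF decidable_conj[OF decidable_not[of P] decidable_not[of Q]]] by simp

lemma decidable_comp: "decidable P \<Longrightarrow> recursive G \<Longrightarrow> decidable (\<lambda>x. P (G x))"
  unfolding decidable_def by (rule recursive_comp)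

lemma decidable_less [recursive_intros]:
  fixes F G :: "'a::code \<Rightarrow> nat"
  assumes "recursive F" "recursive G"
  shows "decidable (\<lambda>x. F x < G x)"
proof -
  have "decidable (\<lambda>x. \<not> G x - F x = 0)"
    by (intro recursive_intros assms)
  then show ?thesis by (simp add: not_le)
qed

lemma recursive_of_bool [recursive_intros]: "decidable P \<Longrightarrow> recursive (\<lambda>x. of_bool (P x) :: nat)"
  by (simp add: decidable_def)

lemma recursive_If [recursive_intros]:
  assumes "decidable P" "recursive F" "recursive G"
  shows "recursive (\<lambda>x. if P x then F x else G x)"
proof (rule recursive_enc_eq)
  show "recursive (\<lambda>x. of_bool (P x) * enc (F x) + of_bool (\<not> P x) * enc (G x))"
    by (intro recursive_intros assms)
qed simp

text \<open>Iterating a step on a coded state is the form of primitive recursion from which bounded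
  quantifiers and \<open>drop\<close> are built.\<close>

lemma recursive_funpow:
  fixes F :: "'a::code \<Rightarrow> 'a"
  assumes "recursive F" "recursive N" "recursive G"
  shows "recursive (\<lambda>x. (F ^^ N x) (G x))"
proof -
  obtain f where f: "\<And>x. reval f [enc x] (enc (F x))"
    using assms(1) unfolding recursive_def by blast
  obtain p where p: "\<And>x. reval p [enc x] (N x)"
    using assms(2) unfolding recursive_def by auto
  obtain g where g: "\<And>x. reval g [enc x] (enc (G x))"
    using assms(3) unfolding recursive_def by blast
  have it: "reval (PrimRec (Proj 0) (Comp f [Proj 1])) [n, enc y] (enc ((F ^^ n) y))" for n and y :: 'a
  proof (rule reval_PrimRec[where F = "\<lambda>n. enc ((F ^^ n) y)"])
    show "reval (Comp f [Proj 1]) [n, enc ((F ^^ n) y), enc y] (enc ((F ^^ Suc n) y))" for n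
      using f[of "(F ^^ n) y"] by (auto intro!: reval_Comp1[of "Proj _"] reval_Proj)
  qed (simp add: reval_Proj)
  show ?thesis
    unfolding recursive_def using reval_Comp2[OF p g it] by blast
qed

lemma decidable_all_less [recursive_intros]:
  fixes N :: "'a::code \<Rightarrow> nat"
  assumes "recursive N" and P: "decidable (\<lambda>z. P (fst z) (snd z))"
  shows "decidable (\<lambda>x. \<forall>i<N x. P i x)"
proof -
  \<comment> \<open>The state holds the counter, the conjunction so far as 0 or 1, and the unchanged
    argument.\<close>
  define step where
    "step = (\<lambda>s :: nat \<times> nat \<times> 'a.
      (Suc (fst s), fst (snd s) * of_bool (P (fst s) (snd (snd s))), snd (snd s)))"
  have "recursive step"
    unfolding step_def
    by (intro recursive_intros recursive_comp2[OF P[unfolded decidable_def]])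
  then have "recursive (\<lambda>x. fst (snd ((step ^^ N x) (0, 1, x))))"
    by (intro recursive_intros recursive_funpow assms(1))
  moreover have "(step ^^ n) (0, 1, x) = (n, of_bool (\<forall>i<n. P i x), x)" for n x
    by (induction n) (auto simp: step_def less_Suc_eq)
  ultimately show ?thesis
    unfolding decidable_def by simp
qed

lemma recursive_Cons [recursive_intros]:
  assumes "recursive F" "recursive G"
  shows "recursive (\<lambda>x. F x # G x)"
proof (rule recursive_enc_eq)
  show "recursive (\<lambda>x. Suc (enc (F x, G x)))"
    by (intro recursive_intros assms)
qed (simp add: enc_Cons enc_prod_def)

lemma dec_prod: "dec n = (dec (fst (prod_decode n)), dec (snd (prod_decode n)))"
proof -
  have "enc (dec n :: 'a \<times> 'b) = enc (dec (fst (prod_decode n)) :: 'a, dec (snd (prod_decode n)) :: 'b)"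
    by (simp only: enc_dec) (simp add: enc_prod_def)
  then show ?thesis by (simp only: enc_eq_iff)
qed

lemma dec_nat [simp]: "dec n = (n :: nat)"
  using enc_dec[of n, where 'a = nat] by (simp del: enc_dec)

lemma recursive_tl [recursive_intros]:
  assumes "recursive F"
  shows "recursive (\<lambda>x. tl (F x))"
proof (rule recursive_comp[OF _ assms], rule recursive_enc_eq)
  show "recursive (\<lambda>xs :: 'b list. snd (dec (enc xs - 1) :: nat \<times> nat))"
    by (intro recursive_intros)
  \<comment> \<open>The empty list needs no case distinction: its code 0 stays 0 when decremented,
    and 0 unpairs to \<open>(0, 0)\<close>, so the tail is again empty.\<close>
  have "prod_encode (0, 0) = 0"
    by (simp add: prod_encode_def)
  then have "prod_decode 0 = (0, 0)"
    by (metis prod_encode_inverse)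
  then show "enc (tl xs) = enc (snd (dec (enc xs - 1) :: nat \<times> nat))" for xs :: "'b list"
    by (cases xs) (simp_all add: enc_Cons dec_prod)
qed

lemma recursive_hd [recursive_intros]:
  assumes "recursive F"
  shows "recursive (\<lambda>x. hd (F x))"
proof (rule recursive_comp[OF _ assms], rule recursive_enc_eq)
  \<comment> \<open>\<open>hd []\<close> is unspecified but fixed, so its code can enter as a
    constant.\<close>
  show "recursive (\<lambda>xs :: 'b list. if xs = [] then enc (hd [] :: 'b) else fst (dec (enc xs - 1) :: nat \<times> nat))"
    by (intro recursive_intros)
  show "enc (hd xs) = enc (if xs = [] then enc (hd [] :: 'b) else fst (dec (enc xs - 1) :: nat \<times> nat))"
    for xs :: "'b list"
    by (cases xs) (simp_all add: enc_Cons dec_prod)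
qed

lemma recursive_drop [recursive_intros]:
  assumes "recursive N" "recursive F"
  shows "recursive (\<lambda>x. drop (N x) (F x))"
proof -
  have "drop n xs = (tl ^^ n) xs" for n and xs :: "'b list"
    by (induction n arbitrary: xs) (simp_all add: funpow_swap1 drop_Suc)
  then show ?thesis
    by (simp add: recursive_funpow recursive_tl recursive_id assms)
qed

lemma decidable_ball_set [recursive_intros]:
  assumes "recursive F" and P: "decidable (\<lambda>z. P (fst z) (snd z))"
  shows "decidable (\<lambda>x. \<forall>y\<in>set (F x). P y x)"
proof -
  \<comment> \<open>Positions between the length and the bound \<open>enc (F x)\<close> pass
    trivially through the first disjunct.\<close>
  have "decidable (\<lambda>x. \<forall>i<enc (F x). drop i (F x) = [] \<or> P (hd (drop i (F x))) x)"
    using decidable_comp[OF P, of "\<lambda>z. (hd (drop (fst z) (F (snd z))), snd z)"]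
    by (intro recursive_intros recursive_comp[OF assms(1)])
      (simp add: recursive_intros recursive_comp[OF assms(1)])
  moreover have "(\<forall>y\<in>set xs. Q y) \<longleftrightarrow> (\<forall>i<enc xs. drop i xs = [] \<or> Q (hd (drop i xs)))"
    for xs :: "'b list" and Q
  proof -
    have "(\<forall>i<enc xs. drop i xs = [] \<or> Q (hd (drop i xs))) \<longleftrightarrow> (\<forall>i<length xs. Q (xs ! i))"
      using length_le_enc[of xs] by (metis drop_eq_Nil hd_drop_conv_nth leD leI less_le_trans)
    then show ?thesis by (simp add: all_set_conv_all_nth)
  qed
  ultimately show ?thesis by simp
qed

lemma decidable_mem [recursive_intros]:
  assumes "recursive F" "recursive G"
  shows "decidable (\<lambda>x. F x \<in> set (G x))"
proof -
  have "decidable (\<lambda>x. \<not> (\<forall>y\<in>set (G x). y \<noteq> F x))"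
    by (intro recursive_intros recursive_comp[OF assms(1)] assms(2))
  then show ?thesis by (simp add: Bex_def)
qed


text \<open>A projection of a decidable predicate instead of the domain of a recursive function:
  connectives and quantifiers then only recombine witnesses, without dovetailing of computations.
  \<open>semidecidable_uniformization\<close> leads back to recursive functions.\<close>

definition semidecidable :: "('a::code \<Rightarrow> bool) \<Rightarrow> bool" where
  "semidecidable P \<longleftrightarrow> (\<exists>D. decidable D \<and> (\<forall>x. P x \<longleftrightarrow> (\<exists>t::nat. D (t, x))))"

named_theorems semidecidable_intros

lemma semidecidable_if_decidable: "decidable P \<Longrightarrow> semidecidable P"
  unfolding semidecidable_def
  by (rule exI[of _ "\<lambda>z. P (snd z)"]) (auto elim!: decidable_comp intro!: recursive_intros)

lemma semidecidableE:
  assumes "semidecidable P"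
  obtains D where "decidable D" "\<And>x. P x \<longleftrightarrow> (\<exists>t::nat. D (t, x))"
  using assms unfolding semidecidable_def by auto

lemma semidecidable_comp:
  assumes "semidecidable P" "recursive G"
  shows "semidecidable (\<lambda>x. P (G x))"
proof -
  from assms(1) obtain D where "decidable D" "\<And>x. P x \<longleftrightarrow> (\<exists>t::nat. D (t, x))"
    by (rule semidecidableE) blast
  then show ?thesis unfolding semidecidable_def
    by (intro exI[of _ "\<lambda>z. D (fst z, G (snd z))"])
      (auto intro!: recursive_intros decidable_comp[of D] recursive_comp[OF assms(2)])
qed

lemma semidecidable_ex [semidecidable_intros]:
  assumes "semidecidable (\<lambda>z. P (fst z) (snd z))"
  shows "semidecidable (\<lambda>x. \<exists>y. P x y)"
proof -
  from assms obtain D where D: "decidable D" "\<And>z. P (fst z) (snd z) \<longleftrightarrow> (\<exists>t::nat. D (t, z))"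
    by (rule semidecidableE) blast
  \<comment> \<open>A single number carries both the quantified object and the witness for
    \<open>P\<close>.\<close>
  define E where
    "E = (\<lambda>z :: nat \<times> 'a. D (fst (dec (fst z) :: nat \<times> 'b), snd z, snd (dec (fst z) :: nat \<times> 'b)))"
  have "decidable E"
    unfolding E_def by (intro recursive_intros decidable_comp[OF D(1)])
  moreover have "(\<exists>y. P x y) \<longleftrightarrow> (\<exists>t::nat. E (t, x))" for x
    unfolding E_def using D(2)[of "(x, _)"] by (metis dec_enc fst_conv snd_conv)
  ultimately show ?thesis
    unfolding semidecidable_def by blast
qed

lemma semidecidable_conj [semidecidable_intros]:
  assumes "semidecidable P" "semidecidable Q"
  shows "semidecidable (\<lambda>x. P x \<and> Q x)"
proof -
  from assms(1) obtain D where D: "decidable D" "\<And>x. P x \<longleftrightarrow> (\<exists>t::nat. D (t, x))"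
    by (rule semidecidableE) blast
  from assms(2) obtain E where E: "decidable E" "\<And>x. Q x \<longleftrightarrow> (\<exists>t::nat. E (t, x))"
    by (rule semidecidableE) blast
  have "semidecidable (\<lambda>x. \<exists>s t. D (s, x) \<and> E (t, x))"
    by (intro semidecidable_intros semidecidable_if_decidable)
      (intro recursive_intros decidable_comp[OF D(1)] decidable_comp[OF E(1)])
  then show ?thesis using D(2) E(2) by simp
qed

lemma semidecidable_disj [semidecidable_intros]:
  assumes "semidecidable P" "semidecidable Q"
  shows "semidecidable (\<lambda>x. P x \<or> Q x)"
proof -
  from assms(1) obtain D where D: "decidable D" "\<And>x. P x \<longleftrightarrow> (\<exists>t::nat. D (t, x))"
    by (rule semidecidableE) blast
  from assms(2) obtain E where E: "decidable E" "\<And>x. Q x \<longleftrightarrow> (\<exists>t::nat. E (t, x))"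
    by (rule semidecidableE) blast
  have "decidable (\<lambda>z. D z \<or> E z)"
    by (intro recursive_intros D(1) E(1))
  with D(2) E(2) show ?thesis
    unfolding semidecidable_def by (intro exI[of _ "\<lambda>z. D z \<or> E z"]) auto
qed

text \<open>One witness for each \<open>i\<close> is chosen, and the list of them becomes the single
  object searched for.\<close>

lemma semidecidable_all_less [semidecidable_intros]:
  fixes N :: "'a::code \<Rightarrow> nat"
  assumes "recursive N" "semidecidable (\<lambda>z. P (fst z) (snd z))"
  shows "semidecidable (\<lambda>x. \<forall>i<N x. P i x)"
proof -
  from assms(2) obtain D where D: "decidable D" "\<And>z. P (fst z) (snd z) \<longleftrightarrow> (\<exists>t::nat. D (t, z))"
    by (rule semidecidableE) blast
  have "semidecidable (\<lambda>x. \<exists>ts. \<forall>i<N x. D (hd (drop i ts), i, x))"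
    by (intro semidecidable_intros semidecidable_if_decidable)
      (intro recursive_intros decidable_comp[OF D(1)] recursive_comp[OF assms(1)])
  moreover have "(\<forall>i<N x. P i x) \<longleftrightarrow> (\<exists>ts. \<forall>i<N x. D (hd (drop i ts), i, x))" for x
  proof
    assume "\<forall>i<N x. P i x"
    then obtain w where "\<forall>i<N x. D (w i, i, x)"
      using D(2)[of "(_, x)"] by (metis fst_conv snd_conv)
    then show "\<exists>ts. \<forall>i<N x. D (hd (drop i ts), i, x)"
      by (intro exI[of _ "map w [0..<N x]"]) (simp add: hd_drop_conv_nth)
  next
    assume "\<exists>ts. \<forall>i<N x. D (hd (drop i ts), i, x)"
    then show "\<forall>i<N x. P i x"
      using D(2)[of "(_, x)"] by auto
  qed
  ultimately show ?thesis by simp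
qed

section \<open>Inductive definitions with semidecidable rules\<close>

primrec derivation :: "('a set \<Rightarrow> 'a \<Rightarrow> bool) \<Rightarrow> 'a list \<Rightarrow> bool" where
  "derivation \<Phi> [] \<longleftrightarrow> True"
| "derivation \<Phi> (j # js) \<longleftrightarrow> \<Phi> (set js) j \<and> derivation \<Phi> js"

text \<open>Replaces recursion over the list by a bounded quantifier over positions, the form to
  which the closure properties apply.\<close>

lemma derivation_iff:
  "derivation \<Phi> js \<longleftrightarrow>
   (\<forall>i<enc js. drop i js = [] \<or> \<Phi> (set (drop (Suc i) js)) (hd (drop i js)))"
proof -
  have "(\<forall>i<n. drop i js = [] \<or> \<Phi> (set (drop (Suc i) js)) (hd (drop i js))) \<longleftrightarrow> derivation \<Phi> js"
    if "length js \<le> n" for n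
    using that
  proof (induction js arbitrary: n)
    case (Cons j js)
    then obtain m where "n = Suc m" "length js \<le> m"
      by (cases n) auto
    with Cons.IH[of m] show ?case
      by (simp add: All_less_Suc2)
  qed simp
  from this[OF length_le_enc] show ?thesis by simp
qed

text \<open>
  Read \<open>\<Phi> A j\<close> as: some rule of an inductive definition of \<open>P\<close> derives \<open>j\<close> from premises in \<open>A\<close>.
  Then \<open>sound\<close> is the introduction rule and \<open>complete\<close> is rule induction.
\<close>

lemma semidecidable_inductive:
  fixes \<Phi> :: "'a::code set \<Rightarrow> 'a \<Rightarrow> bool"
  assumes \<Phi>: "semidecidable (\<lambda>z. \<Phi> (set (fst z)) (snd z))"
    and mono: "\<And>A B j. \<Phi> A j \<Longrightarrow> A \<subseteq> B \<Longrightarrow> \<Phi> B j"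
    and sound: "\<And>A j. \<Phi> A j \<Longrightarrow> \<forall>i\<in>A. P i \<Longrightarrow> P j"
    and complete: "\<And>Q j. (\<And>A j. finite A \<Longrightarrow> \<Phi> A j \<Longrightarrow> \<forall>i\<in>A. Q i \<Longrightarrow> Q j) \<Longrightarrow> P j \<Longrightarrow> Q j"
  shows "semidecidable P"
proof -
  have "semidecidable (\<lambda>j. \<exists>js. derivation \<Phi> js \<and> j \<in> set js)"
    unfolding derivation_iff
    by (intro semidecidable_intros recursive_intros)
      (rule semidecidable_if_decidable recursive_intros
        semidecidable_comp[OF \<Phi>, of "\<lambda>z. (drop (Suc (fst z)) (snd (snd z)), hd (drop (fst z) (snd (snd z))))", simplified])+
  moreover have "P j \<longleftrightarrow> (\<exists>js. derivation \<Phi> js \<and> j \<in> set js)" for j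
  proof
    \<comment> \<open>Monotonicity lets derivations be concatenated. As \<open>A\<close> below is
      finite, derivations of all its members fit into one list.\<close>
    have app: "derivation \<Phi> (js @ ks)" if "derivation \<Phi> js" "derivation \<Phi> ks" for js ks
      using that by (induction js) (auto intro: mono)
    assume "P j"
    then show "\<exists>js. derivation \<Phi> js \<and> j \<in> set js"
    proof (rule complete[rotated])
      fix A j
      assume "finite A" "\<Phi> A j" "\<forall>i\<in>A. \<exists>js. derivation \<Phi> js \<and> i \<in> set js"
      from this(1,3) have "\<exists>js. derivation \<Phi> js \<and> A \<subseteq> set js"
      proof (induction A)
        case empty
        then show ?case by (intro exI[of _ "[]"]) simp
      next
        case (insert i A)
        then obtain js ks where "derivation \<Phi> js" "i \<in> set js" "derivation \<Phi> ks" "A \<subseteq> set ks"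
          by auto
        then show ?case by (intro exI[of _ "js @ ks"]) (auto intro: app)
      qed
      with \<open>\<Phi> A j\<close> obtain js where "derivation \<Phi> (j # js)"
        using mono by auto
      then show "\<exists>js. derivation \<Phi> js \<and> j \<in> set js"
        by (intro exI[of _ "j # js"]) simp
    qed
  next
    have "\<forall>j\<in>set js. P j" if "derivation \<Phi> js" for js
      using that by (induction js) (auto intro: sound)
    then show "\<exists>js. derivation \<Phi> js \<and> j \<in> set js \<Longrightarrow> P j" by blast
  qed
  ultimately show ?thesis
    by presburger
qed

text \<open>The least code of a pair of a witness and a value is found by minimization, and the
  value is projected out. \<open>R\<close> may relate several values to \<open>x\<close>;
  \<open>f\<close> settles on one of them, which is why definedness is stated with a fresh
  \<open>y\<close>.\<close>

lemma semidecidable_uniformization: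
  fixes R :: "'a::code \<Rightarrow> 'b::code \<Rightarrow> bool"
  assumes "semidecidable (\<lambda>z. R (fst z) (snd z))"
  obtains f where "\<And>x y. reval f [enc x] (enc y) \<Longrightarrow> R x y"
    and "\<And>x y. R x y \<Longrightarrow> \<exists>y :: 'b. reval f [enc x] (enc y)"
proof -
  from assms obtain D where D: "decidable D" and
    "\<And>z. R (fst z) (snd z) \<longleftrightarrow> (\<exists>t::nat. D (t, z))"
    by (rule semidecidableE) blast
  then have R: "R x y \<longleftrightarrow> (\<exists>t::nat. D (t, x, y))" for x y
    by (metis fst_conv snd_conv)
  define E where
    "E = (\<lambda>z :: nat \<times> 'a. D (fst (dec (fst z) :: nat \<times> 'b), snd z, snd (dec (fst z) :: nat \<times> 'b)))"
  have R_iff: "R x y \<longleftrightarrow> (\<exists>t::nat. E (enc (t, y), x))" for x y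
    by (simp add: E_def R)
  \<comment> \<open>Minimization looks for a zero, hence the negation.\<close>
  have "recursive (\<lambda>z. of_bool (\<not> E z) :: nat)"
    unfolding E_def by (intro recursive_intros decidable_comp[OF D])
  then obtain g where g: "\<And>z. reval g [enc z] (of_bool (\<not> E z))"
    unfolding recursive_def by auto
  obtain p where p: "\<And>m n. reval p [m, n] (prod_encode (m, n))"
    using reval_prod_encode by blast
  have "recursive (\<lambda>t. snd (dec t :: nat \<times> 'b))"
    by (intro recursive_intros)
  then obtain s where s: "\<And>t. reval s [t] (enc (snd (dec t :: nat \<times> 'b)))"
    unfolding recursive_def by auto
  define q where "q = Comp g [p]"
  have q: "reval q [t, enc x] (of_bool (\<not> E (t, x)))" for t x
    using g[of "(t, x)"] p[of t "enc x"] unfolding q_def by (auto intro: reval_Comp1 simp: enc_prod_def)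
  show thesis
  proof (rule that[of "Comp s [Minimize q]"])
    fix x :: 'a and y :: 'b
    assume "reval (Comp s [Minimize q]) [enc x] (enc y)"
    then obtain t where t: "reval (Minimize q) [enc x] t" "reval s [t] (enc y)"
      by (auto elim!: reval_elims(4) simp: list_all2_Cons1)
    from t(1) have "reval q [t, enc x] 0"
      by (auto elim: reval_elims(7))
    from reval_deterministic[OF this q] have "E (t, x)"
      by simp
    moreover have "snd (dec t :: nat \<times> 'b) = y"
      using reval_deterministic[OF s t(2)] by simp
    ultimately have "D (fst (dec t :: nat \<times> 'b), x, y)"
      by (simp add: E_def)
    then show "R x y"
      using R by blast
  next
    fix x :: 'a and y :: 'b
    assume "R x y"
    then have ex: "\<exists>t. E (t, x)"
      using R_iff by blast
    define t where "t = (LEAST t. E (t, x))"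
    have "E (t, x)" and least: "\<And>u. u < t \<Longrightarrow> \<not> E (u, x)"
      unfolding t_def using ex by (auto intro: LeastI dest: not_less_Least)
    then have "reval (Minimize q) [enc x] t"
      using q[of _ x] by (intro reval.intros(7)) (metis of_bool_eq(1) One_nat_def of_bool_eq(2))+
    then show "\<exists>y :: 'b. reval (Comp s [Minimize q]) [enc x] (enc y)"
      using s reval_Comp1 by blast
  qed
qed

lemma semidecidable_comp2:
  assumes "semidecidable (\<lambda>(a, b). P a b)" "recursive F" "recursive G"
  shows "semidecidable (\<lambda>x. P (F x) (G x))"
  using semidecidable_comp[OF assms(1) recursive_Pair[OF assms(2,3)]] by simp

lemma semidecidable_comp3:
  assumes "semidecidable (\<lambda>(a, b, c). P a b c)" "recursive F" "recursive G" "recursive H"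
  shows "semidecidable (\<lambda>x. P (F x) (G x) (H x))"
  using semidecidable_comp[OF assms(1) recursive_Pair[OF assms(2) recursive_Pair[OF assms(3,4)]]]
  by simp

lemma semidecidable_comp5:
  assumes "semidecidable (\<lambda>(a, b, c, d, e). P a b c d e)"
    "recursive F" "recursive G" "recursive H" "recursive I" "recursive J"
  shows "semidecidable (\<lambda>x. P (F x) (G x) (H x) (I x) (J x))"
  using semidecidable_comp[OF assms(1) recursive_Pair[OF assms(2) recursive_Pair[OF assms(3)
    recursive_Pair[OF assms(4) recursive_Pair[OF assms(5,6)]]]]]
  by simp

section \<open>Computability of IMP2\<close>

lemma bstr_snoc: "c < 2 \<Longrightarrow> bstr (Suc (2 * k + c)) = bstr k @ [c = 1]"
  by (auto simp: less_2_cases_iff)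

lemma bstr_eq_iff [simp]: "bstr m = bstr n \<longleftrightarrow> m = n"
  using inj_bstr by (auto dest: injD)

text \<open>Appending the bit \<open>c\<close> to the string at position \<open>k\<close> leads to
  position \<open>2 * k + 1 + c\<close>. The rules thus recurse on the last bit of the second
  operand.\<close>

lemma semidecidable_append: "semidecidable (\<lambda>(m, n, r). bstr r = bstr m @ bstr n)"
\<comment> \<open>Here and below the cases follow the assumptions of
  \<open>semidecidable_inductive\<close>: the rules are semidecidable, monotone, sound and complete.
  In case 4 the first fact applies a rule to an explicitly given finite set of premises.\<close>
proof (rule semidecidable_inductive[where \<Phi> = "\<lambda>A (m, n, r). (n = 0 \<and> r = m) \<or>
    (\<exists>k s c. c < 2 \<and> n = Suc (2 * k + c) \<and> r = Suc (2 * s + c) \<and> (m, k, s) \<in> A)"], goal_cases)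
  case 1
  show ?case unfolding case_prod_beta
    by (rule semidecidable_intros semidecidable_if_decidable recursive_intros)+
next
  case (4 Q j)
  obtain m n r where j: "j = (m, n, r)" by (cases j)
  have "Q (m, n, r)" if "bstr r = bstr m @ bstr n" for r
    using that
  proof (induction n arbitrary: r rule: bstr.induct)
    case 1
    then show ?case by (intro "4"(1)[of "{}"]) auto
  next
    case (2 n)
    then obtain s where s: "r = Suc (2 * s + of_bool (odd n))" "bstr s = bstr m @ bstr (n div 2)"
      using bstr_snoc_eq_iff[of r "bstr m @ bstr (n div 2)" "odd n"] by auto
    moreover have "n = 2 * (n div 2) + of_bool (odd n)" by simp
    ultimately show ?case
      by (intro "4"(1)[of "{(m, n div 2, s)}"]) (use "2.IH"[OF s(2)] in auto)
  qed
  with "4"(2) show ?case by (simp add: j)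
qed (auto simp: bstr_snoc simp del: bstr.simps(2))

text \<open>Treats the unary header of \<open>selfdelim\<close>: each bit peeled off
  \<open>n\<close>, whatever its value, is matched by a bit 1 at the end of
  \<open>r\<close>.\<close>

lemma semidecidable_replicate_length:
  "semidecidable (\<lambda>(n, r). bstr r = replicate (length (bstr n)) True)"
proof (rule semidecidable_inductive[where \<Phi> = "\<lambda>A (n, r). (n = 0 \<and> r = 0) \<or>
    (\<exists>k s c. c < 2 \<and> n = Suc (2 * k + c) \<and> r = Suc (2 * s + 1) \<and> (k, s) \<in> A)"], goal_cases)
  case 1
  show ?case unfolding case_prod_beta
    by (rule semidecidable_intros semidecidable_if_decidable recursive_intros)+
next
  case (4 Q j)
  obtain n r where j: "j = (n, r)" by (cases j)
  have "Q (n, r)" if "bstr r = replicate (length (bstr n)) True" for r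
    using that
  proof (induction n arbitrary: r rule: bstr.induct)
    case 1
    then show ?case by (intro "4"(1)[of "{}"]) auto
  next
    case (2 n)
    then obtain s where s: "r = Suc (2 * s + of_bool True)" "bstr s = replicate (length (bstr (n div 2))) True"
      using bstr_snoc_eq_iff[of r "replicate (length (bstr (n div 2))) True" True]
      by (auto simp: replicate_append_same)
    moreover have "\<exists>c<2. n = 2 * (n div 2) + c" by presburger
    ultimately show ?case
      by (intro "4"(1)[of "{(n div 2, s)}"]) (use "2.IH"[OF s(2)] in auto)
  qed
  with "4"(2) show ?case by (simp add: j)
next
  case (3 A j)
  then show ?case
    using bstr_snoc[of 1] by (auto simp: bstr_snoc replicate_append_same simp del: bstr.simps(2))
qed auto

lemma semidecidable_tuple: "semidecidable (\<lambda>(n, y, w). bstr w = tuple n (bstr y))"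
proof -
  \<comment> \<open>\<open>u\<close>, \<open>v\<close>, \<open>s\<close> are the positions of the
    growing initial parts of \<open>w\<close>; \<open>bstr 1\<close> is the separating bit
    0.\<close>
  have "semidecidable (\<lambda>(n, y, w). \<exists>u v s. bstr u = replicate (length (bstr n)) True \<and>
      bstr v = bstr u @ bstr 1 \<and> bstr s = bstr v @ bstr n \<and> bstr w = bstr s @ bstr y)"
    unfolding case_prod_beta
    by (rule semidecidable_intros semidecidable_comp2[OF semidecidable_replicate_length]
        semidecidable_comp3[OF semidecidable_append] recursive_intros)+
  moreover have "(\<exists>u v s. bstr u = replicate (length (bstr n)) True \<and>
      bstr v = bstr u @ bstr 1 \<and> bstr s = bstr v @ bstr n \<and> bstr w = bstr s @ bstr y) \<longleftrightarrow>
      bstr w = tuple n (bstr y)" for n y w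
  proof -
    have ex: "\<exists>u. bstr u = x" for x
      using surj_bstr unfolding surj_def by metis
    have "bstr 1 = [False]" by simp
    with ex show ?thesis unfolding tuple_def selfdelim_def
      by (metis append.assoc)
  qed
  ultimately show ?thesis by simp
qed

text \<open>
  Memories are coded by association lists in which newer entries shadow older ones, and strings by
  their positions in the enumeration \<^const>\<open>bstr\<close>.
\<close>

definition lookup :: "(nat \<times> nat) list \<Rightarrow> mem" where
  "lookup l = (\<lambda>i. case map_of l i of None \<Rightarrow> 0 | Some v \<Rightarrow> v)"

lemma lookup_Nil [simp]: "lookup [] = (\<lambda>_. 0)"
  by (simp add: lookup_def)

lemma lookup_Cons [simp]: "lookup ((i, v) # l) = (lookup l)(i := v)"
  by (auto simp: lookup_def)

lemma semidecidable_lookup: "semidecidable (\<lambda>(l, i, v). lookup l i = v)"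
proof (rule semidecidable_inductive[where \<Phi> = "\<lambda>A (l, i, v). (l = [] \<and> v = 0) \<or>
    (\<exists>k u m. l = (k, u) # m \<and> (i = k \<and> v = u \<or> i \<noteq> k \<and> (m, i, v) \<in> A))"], goal_cases)
  case 1
  show ?case unfolding case_prod_beta
    by (rule semidecidable_intros semidecidable_if_decidable recursive_intros)+
next
  case (4 Q j)
  obtain l i v where j: "j = (l, i, v)" by (cases j)
  have "Q (l, i, lookup l i)"
  proof (induction l)
    case Nil
    show ?case by (intro "4"(1)[of "{}"]) auto
  next
    case (Cons p l)
    then show ?case by (cases p, intro "4"(1)[of "{(l, i, lookup l i)}"]) auto
  qed
  with "4"(2) show ?case by (simp add: j)
qed auto

text \<open>\<open>out\<close> cuts off at the least possible bound, but by \<open>out_eq\<close>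
  every bound above all keys of the list gives the same string, and being such a bound is
  decidable.\<close>

lemma semidecidable_out: "semidecidable (\<lambda>(l, x). bstr x = out (lookup l))"
proof -
  have *: "semidecidable (\<lambda>(l, k, x). bstr x = concat (map (\<lambda>i. bstr (lookup l i)) [0..<k]))"
  proof (rule semidecidable_inductive[where \<Phi> = "\<lambda>A (l, k, x). (k = 0 \<and> x = 0) \<or>
    (\<exists>j u v. k = Suc j \<and> (l, j, u) \<in> A \<and> lookup l j = v \<and> bstr x = bstr u @ bstr v)"], goal_cases)
    case 1
    show ?case unfolding case_prod_beta
      by (rule semidecidable_intros semidecidable_comp3[OF semidecidable_lookup]
        semidecidable_comp3[OF semidecidable_append] semidecidable_if_decidable recursive_intros)+
  next
    case (4 Q j)
    obtain l k x where j: "j = (l, k, x)" by (cases j)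
    have "Q (l, k, x)" if "bstr x = concat (map (\<lambda>i. bstr (lookup l i)) [0..<k])" for x
      using that
    proof (induction k arbitrary: x)
      case 0
      then show ?case by (intro "4"(1)[of "{}"]) auto
    next
      case (Suc k)
      obtain u where u: "bstr u = concat (map (\<lambda>i. bstr (lookup l i)) [0..<k])"
        using surj_bstr unfolding surj_def by metis
      show ?case
        by (intro "4"(1)[of "{(l, k, u)}"]) (use Suc.IH[OF u] Suc.prems u in auto)
    qed
    with "4"(2) show ?case by (simp add: j)
  qed auto
  have "semidecidable (\<lambda>(l, x). \<exists>k. (\<forall>p\<in>set l. fst p < k) \<and>
      bstr x = concat (map (\<lambda>i. bstr (lookup l i)) [0..<k]))"
    unfolding case_prod_beta
    by (rule semidecidable_intros semidecidable_comp3[OF *] semidecidable_if_decidable recursive_intros)+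
  moreover have "(\<exists>k. (\<forall>p\<in>set l. fst p < k) \<and>
      bstr x = concat (map (\<lambda>i. bstr (lookup l i)) [0..<k])) \<longleftrightarrow> bstr x = out (lookup l)" for l x
  proof -
    have *: "out (lookup l) = concat (map (\<lambda>i. bstr (lookup l i)) [0..<k])"
      if "\<forall>p\<in>set l. fst p < k" for k
    proof (rule out_eq, intro allI impI)
      fix i assume "k \<le> i"
      with that have "map_of l i = None"
        by (auto simp: map_of_eq_None_iff)
      then show "lookup l i = 0" by (simp add: lookup_def)
    qed
    have "\<forall>p\<in>set l. fst p < Suc (Max (fst ` set l))"
      by (auto simp: less_Suc_eq_le)
    then obtain K where "\<forall>p\<in>set l. fst p < K" by blast
    with * show ?thesis by (intro iffI exI[of _ K]) (auto dest: *)
  qed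
  ultimately show ?thesis by simp
qed

text \<open>The rules below take a sentence apart by quantifying over its components and comparing
  it with the term built from them, so it is the constructors that have to be recursive.\<close>

lemma recursive_aexp [recursive_intros]:
  assumes "recursive F" "recursive G"
  shows "recursive (\<lambda>x. Plus (F x) (G x))" "recursive (\<lambda>x. Minus (F x) (G x))"
    "recursive (\<lambda>x. Times (F x) (G x))"
proof -
  have *: "recursive (\<lambda>x. 5 * enc (F x, G x) + n)" for n
    by (intro recursive_intros assms)
  show "recursive (\<lambda>x. Plus (F x) (G x))"
    by (rule recursive_enc_eq[OF *]) (simp add: enc_aexp_def enc_prod_def)
  show "recursive (\<lambda>x. Minus (F x) (G x))"
    by (rule recursive_enc_eq[OF *]) (simp add: enc_aexp_def enc_prod_def)
  show "recursive (\<lambda>x. Times (F x) (G x))"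
    by (rule recursive_enc_eq[OF *]) (simp add: enc_aexp_def enc_prod_def)
qed

lemma recursive_Num_Loc [recursive_intros]:
  assumes "recursive F"
  shows "recursive (\<lambda>x. Num (F x))" "recursive (\<lambda>x. Loc (F x))"
proof -
  have *: "recursive (\<lambda>x. 5 * F x + n)" for n
    by (intro recursive_intros assms)
  show "recursive (\<lambda>x. Num (F x))"
    by (rule recursive_enc_eq[OF *]) (simp add: enc_aexp_def)
  show "recursive (\<lambda>x. Loc (F x))"
    by (rule recursive_enc_eq[OF *]) (simp add: enc_aexp_def)
qed

lemma recursive_Equal_Less [recursive_intros]:
  assumes "recursive F" "recursive G"
  shows "recursive (\<lambda>x. Equal (F x) (G x))" "recursive (\<lambda>x. Less (F x) (G x))"
proof -
  have *: "recursive (\<lambda>x. 5 * enc (F x, G x) + n)" for n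
    by (intro recursive_intros assms)
  show "recursive (\<lambda>x. Equal (F x) (G x))"
    by (rule recursive_enc_eq[OF *]) (simp add: enc_aexp_def enc_bexp_def enc_prod_def)
  show "recursive (\<lambda>x. Less (F x) (G x))"
    by (rule recursive_enc_eq[OF *]) (simp add: enc_aexp_def enc_bexp_def enc_prod_def)
qed

lemma recursive_And_Or_Not [recursive_intros]:
  assumes "recursive F" "recursive G"
  shows "recursive (\<lambda>x. And (F x) (G x))" "recursive (\<lambda>x. Or (F x) (G x))"
    "recursive (\<lambda>x. Not (F x))"
proof -
  have *: "recursive (\<lambda>x. 5 * enc (F x, G x) + n)" and **: "recursive (\<lambda>x. 5 * enc (F x) + n)" for n
    by (intro recursive_intros assms)+
  show "recursive (\<lambda>x. And (F x) (G x))"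
    by (rule recursive_enc_eq[OF *]) (simp add: enc_bexp_def enc_prod_def)
  show "recursive (\<lambda>x. Or (F x) (G x))"
    by (rule recursive_enc_eq[OF *]) (simp add: enc_bexp_def enc_prod_def)
  show "recursive (\<lambda>x. Not (F x))"
    by (rule recursive_enc_eq[OF **]) (simp add: enc_bexp_def)
qed

lemma recursive_four_enc:
  "recursive F \<Longrightarrow> recursive G \<Longrightarrow> recursive (\<lambda>x. 4 * enc (F x, G x) + n)"
  by (intro recursive_intros)

lemma recursive_com [recursive_intros]:
  "recursive I \<Longrightarrow> recursive A \<Longrightarrow> recursive (\<lambda>x. Assign (I x) (A x))"
  "recursive B \<Longrightarrow> recursive P \<Longrightarrow> recursive (\<lambda>x. While (B x) (P x))"
  "recursive P \<Longrightarrow> recursive Q \<Longrightarrow> recursive (\<lambda>x. Seq (P x) (Q x))"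
  "recursive B \<Longrightarrow> recursive P \<Longrightarrow> recursive Q \<Longrightarrow> recursive (\<lambda>x. If (B x) (P x) (Q x))"
proof -
  note [simp] = enc_aexp_def enc_bexp_def enc_com_def enc_prod_def
  show "recursive (\<lambda>x. Assign (I x) (A x))" if "recursive I" "recursive A"
    by (rule recursive_enc_eq[OF recursive_four_enc[OF that]]) simp
  show "recursive (\<lambda>x. While (B x) (P x))" if "recursive B" "recursive P"
    by (rule recursive_enc_eq[OF recursive_four_enc[OF that]]) simp
  show "recursive (\<lambda>x. Seq (P x) (Q x))" if "recursive P" "recursive Q"
    by (rule recursive_enc_eq[OF recursive_four_enc[OF that]]) simp
  show "recursive (\<lambda>x. If (B x) (P x) (Q x))" if "recursive B" "recursive P" "recursive Q"
    by (rule recursive_enc_eq[OF recursive_four_enc[OF that(1) recursive_Pair[OF that(2,3)]]]) simp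
qed

section \<open>Semidecidability of evaluation and execution\<close>

lemma obtain_bstr:
  obtains n where "bstr n = w"
  using surj_bstr unfolding surj_def by metis

lemma semidecidable_aval:
  "semidecidable (\<lambda>(a, l, y, v, y'). aval a (lookup l) (bstr y) = Some (v, bstr y'))"
\<comment> \<open>For \<open>v < 2\<close>, \<open>bstr (Suc v)\<close> is the one-bit string whose
  bit has the value \<open>v\<close>.\<close>
proof (rule semidecidable_inductive[where \<Phi> = "\<lambda>A (a, l, y, v, y').
    (a = ReadBit \<and> v < 2 \<and> bstr y = bstr (Suc v) @ bstr y') \<or>
    (a = Num v \<and> y' = y) \<or>
    (\<exists>i. a = Loc i \<and> lookup l i = v \<and> y' = y) \<or>
    (\<exists>b c m n z. (b, l, y, m, z) \<in> A \<and> (c, l, z, n, y') \<in> A \<and>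
      (a = Plus b c \<and> v = m + n \<or> a = Minus b c \<and> v = m - n \<or> a = Times b c \<and> v = m * n))"],
    goal_cases)
  case 1
  show ?case unfolding case_prod_beta
    by (rule semidecidable_intros semidecidable_comp3[OF semidecidable_lookup]
        semidecidable_comp3[OF semidecidable_append] semidecidable_if_decidable recursive_intros)+
next
  case (2 A B j)
  then show ?case unfolding case_prod_beta by blast
next
  case (3 A j)
  have A: "aval a (lookup l) (bstr y) = Some (v, bstr y')" if "(a, l, y, v, y') \<in> A" for a l y v y'
    using "3"(2) that by auto
  from "3"(1) show ?case by (auto simp: less_2_cases_iff dest!: A)
next
  case (4 Q j)
  obtain a l y v y' where j: "j = (a, l, y, v, y')" by (cases j)
  have binop: "Q (a, l, y, v, y')"
    if IH: "\<And>y v y'. aval b (lookup l) (bstr y) = Some (v, bstr y') \<Longrightarrow> Q (b, l, y, v, y')"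
      "\<And>y v y'. aval c (lookup l) (bstr y) = Some (v, bstr y') \<Longrightarrow> Q (c, l, y, v, y')"
    and "aval b (lookup l) (bstr y) = Some (m, z)" "aval c (lookup l) z = Some (n, bstr y')"
    and "a = Plus b c \<and> v = m + n \<or> a = Minus b c \<and> v = m - n \<or> a = Times b c \<and> v = m * n"
    for a b c y v y' m n z
  proof -
    \<comment> \<open>The input left between the two operands is a string; the judgements need its
      position.\<close>
    obtain k where "bstr k = z" by (rule obtain_bstr)
    show ?thesis
    proof (rule "4"(1)[of "{(b, l, y, m, k), (c, l, k, n, y')}"], goal_cases)
      case 2
      show ?case unfolding prod.case
        by (intro disjI2, rule exI[of _ b], rule exI[of _ c], rule exI[of _ m], rule exI[of _ n],
            rule exI[of _ k]) (use that(5) in auto)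
    qed (use that(1-4) \<open>bstr k = z\<close> in auto)
  qed
  have "Q (a, l, y, v, y')" if "aval a (lookup l) (bstr y) = Some (v, bstr y')" for y v y'
    using that
  proof (induction a arbitrary: y v y')
    case ReadBit
    then obtain b where b: "bstr y = b # bstr y'" "v = of_bool b"
      by (auto split: list.splits)
    then have "bstr (Suc v) = [b]"
      by (cases b) auto
    with b show ?case by (intro "4"(1)[of "{}"]) auto
  next
    case (Num n)
    then show ?case by (intro "4"(1)[of "{}"]) auto
  next
    case (Loc i)
    then show ?case by (intro "4"(1)[of "{}"]) auto
  next
    case (Plus b c)
    from Plus.prems show ?case
      by (auto simp: bind_eq_Some_conv intro: binop[OF Plus.IH])
  next
    case (Minus b c)
    from Minus.prems show ?case
      by (auto simp: bind_eq_Some_conv intro: binop[OF Minus.IH])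
  next
    case (Times b c)
    from Times.prems show ?case
      by (auto simp: bind_eq_Some_conv intro: binop[OF Times.IH])
  qed
  with "4"(2) show ?case by (simp add: j)
qed

text \<open>Truth values enter as 0 and 1, since a two-element type has no bijection with the
  natural numbers and hence no \<open>code\<close> instance. The bound on \<open>v\<close> makes
  this representation unique.\<close>

lemma semidecidable_bval:
  "semidecidable (\<lambda>(b, l, y, v :: nat, y'). v < 2 \<and> bval b (lookup l) (bstr y) = Some (v = 1, bstr y'))"
proof (rule semidecidable_inductive[where \<Phi> = "\<lambda>A (b, l, y, v, y').
    (b = TrueB \<and> v = 1 \<and> y' = y) \<or>
    (b = FalseB \<and> v = 0 \<and> y' = y) \<or>
    (\<exists>a c m n z. aval a (lookup l) (bstr y) = Some (m, bstr z) \<and>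
      aval c (lookup l) (bstr z) = Some (n, bstr y') \<and>
      (b = Equal a c \<and> v = of_bool (m = n) \<or> b = Less a c \<and> v = of_bool (m < n))) \<or>
    (\<exists>a c m n z. (a, l, y, m, z) \<in> A \<and> (c, l, z, n, y') \<in> A \<and>
      (b = And a c \<and> v = of_bool (m = 1 \<and> n = 1) \<or> b = Or a c \<and> v = of_bool (m = 1 \<or> n = 1))) \<or>
    (\<exists>a m. (a, l, y, m, y') \<in> A \<and> b = Not a \<and> v = of_bool (m \<noteq> 1))"],
    goal_cases)
  case 1
  show ?case unfolding case_prod_beta
    by (rule semidecidable_intros semidecidable_comp5[OF semidecidable_aval]
        semidecidable_if_decidable recursive_intros)+
next
  case (2 A B j)
  then show ?case unfolding case_prod_beta by blast
next
  case (3 A j)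
  have A: "v < 2" "bval b (lookup l) (bstr y) = Some (v = 1, bstr y')"
    if "(b, l, y, v, y') \<in> A" for b l y v y'
    using "3"(2) that by auto
  from "3"(1) show ?case by (auto dest!: A)
next
  case (4 Q j)
  obtain b l y v y' where j: "j = (b, l, y, v, y')" by (cases j)
  have cmp: "Q (b, l, y, v, y')"
    if "aval a (lookup l) (bstr y) = Some (m, z)" "aval c (lookup l) z = Some (n, bstr y')"
    and "b = Equal a c \<and> v = of_bool (m = n) \<or> b = Less a c \<and> v = of_bool (m < n)"
    for a b c y v y' m n z
  proof -
    obtain k where "bstr k = z" by (rule obtain_bstr)
    show ?thesis
    proof (rule "4"(1)[of "{}"], goal_cases)
      case 2
      show ?case unfolding prod.case
        by (rule disjI2, rule disjI2, rule disjI1, rule exI[of _ a], rule exI[of _ c],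
            rule exI[of _ m], rule exI[of _ n], rule exI[of _ k])
          (use that \<open>bstr k = z\<close> in auto)
    qed simp_all
  qed
  have binop: "Q (b, l, y, v, y')"
    if IH: "\<And>y v y'. v < 2 \<Longrightarrow> bval a (lookup l) (bstr y) = Some (v = 1, bstr y') \<Longrightarrow> Q (a, l, y, v, y')"
      "\<And>y v y'. v < 2 \<Longrightarrow> bval c (lookup l) (bstr y) = Some (v = 1, bstr y') \<Longrightarrow> Q (c, l, y, v, y')"
    and "bval a (lookup l) (bstr y) = Some (m, z)" "bval c (lookup l) z = Some (n, bstr y')"
    and "b = And a c \<and> v = of_bool (m \<and> n) \<or> b = Or a c \<and> v = of_bool (m \<or> n)"
    for a b c y v y' m n z
  proof -
    obtain k where "bstr k = z" by (rule obtain_bstr)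
    show ?thesis
    proof (rule "4"(1)[of "{(a, l, y, of_bool m, k), (c, l, k, of_bool n, y')}"], goal_cases)
      case 2
      show ?case unfolding prod.case
        by (rule disjI2, rule disjI2, rule disjI2, rule disjI1, rule exI[of _ a], rule exI[of _ c],
            rule exI[of _ "of_bool m"], rule exI[of _ "of_bool n"], rule exI[of _ k])
          (use that(5) in auto)
    qed (use that(1-4) \<open>bstr k = z\<close> in auto)
  qed
  have "Q (b, l, y, v, y')"
    if "v < 2" "bval b (lookup l) (bstr y) = Some (v = 1, bstr y')" for y v y'
    using that
  proof (induction b arbitrary: y v y')
    case TrueB
    then show ?case by (intro "4"(1)[of "{}"]) auto
  next
    case FalseB
    then show ?case by (intro "4"(1)[of "{}"]) auto
  next
    case (Equal a c)
    from Equal.prems show ?case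
      by (auto simp: bind_eq_Some_conv intro!: cmp)
  next
    case (Less a c)
    from Less.prems show ?case
      by (auto simp: bind_eq_Some_conv intro!: cmp)
  next
    case (And a c)
    from And.prems show ?case
      by (auto simp: bind_eq_Some_conv intro!: binop[OF And.IH])
  next
    case (Or a c)
    from Or.prems show ?case
      by (auto simp: bind_eq_Some_conv intro!: binop[OF Or.IH])
  next
    case (Not a)
    from Not.prems Not.IH[of "1 - v"] show ?case
      by (intro "4"(1)[of "{(a, l, y, 1 - v, y')}"]) (auto simp: bind_eq_Some_conv less_2_cases_iff)
  qed
  with "4"(2) show ?case by (simp add: j)
qed

lemma semidecidable_bval_eq:
  assumes "recursive B" "recursive L" "recursive Y" "recursive Y'"
  shows "semidecidable (\<lambda>x. bval (B x) (lookup (L x)) (bstr (Y x)) = Some (w, bstr (Y' x)))"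
  using semidecidable_comp5[OF semidecidable_bval assms(1-3) recursive_const[of "of_bool w"] assms(4)]
  by (cases w) simp_all

text \<open>\<open>exec\<close> restated on codable states: arbitrary functions as memories are
  uncountably many, association lists are not. Many lists represent the same memory, and an
  assignment merely adds an entry.\<close>

inductive lexec :: "com \<Rightarrow> (nat \<times> nat) list \<Rightarrow> nat \<Rightarrow> (nat \<times> nat) list \<Rightarrow> nat \<Rightarrow> bool" where
  Skip: "lexec Skip l y l y"
| Assign: "aval a (lookup l) (bstr y) = Some (n, bstr y') \<Longrightarrow> lexec (Assign i a) l y ((i, n) # l) y'"
| WhileFalse: "bval b (lookup l) (bstr y) = Some (False, bstr y') \<Longrightarrow> lexec (While b p) l y l y'"
| WhileTrue: "bval b (lookup l) (bstr y) = Some (True, bstr z) \<Longrightarrow> lexec p l z m u \<Longrightarrow>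
    lexec (While b p) m u l' y' \<Longrightarrow> lexec (While b p) l y l' y'"
| Seq: "lexec p l y m u \<Longrightarrow> lexec q m u l' y' \<Longrightarrow> lexec (Seq p q) l y l' y'"
| If: "bval b (lookup l) (bstr y) = Some (w, bstr z) \<Longrightarrow> lexec (if w then p else q) l z l' y' \<Longrightarrow>
    lexec (If b p q) l y l' y'"

lemma exec_if_lexec: "lexec p l y l' y' \<Longrightarrow> exec p (lookup l, bstr y) (lookup l', bstr y')"
proof (induction rule: lexec.induct)
  case (Assign a l y n y' i)
  then show ?case unfolding lookup_Cons by (rule exec.Assign)
next
  case (If b l y w z p q l' y')
  then show ?case by (cases w) (auto intro: exec.intros)
qed (auto intro: exec.intros)

text \<open>A run from a represented memory stays within represented ones, so no halting run of
  \<open>exec\<close> is lost.\<close>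

lemma lexec_if_exec:
  "exec p \<sigma> \<tau> \<Longrightarrow> \<sigma> = (lookup l, bstr y) \<Longrightarrow>
   \<exists>l' y'. \<tau> = (lookup l', bstr y') \<and> lexec p l y l' y'"
proof (induction arbitrary: l y rule: exec.induct)
  case (Skip \<sigma>)
  then show ?case by (blast intro: lexec.Skip)
next
  case (Assign a s y0 n z i)
  obtain y' where y': "bstr y' = z" by (rule obtain_bstr)
  with Assign show ?case
    by (intro exI[of _ "(i, n) # l"] exI[of _ y']) (auto intro: lexec.Assign)
next
  case (WhileFalse b s y0 z p)
  obtain y' where y': "bstr y' = z" by (rule obtain_bstr)
  with WhileFalse show ?case
    by (intro exI[of _ l] exI[of _ y']) (auto intro: lexec.WhileFalse)
next
  case (WhileTrue b s y0 z p \<sigma> \<tau>)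
  obtain y' where y': "bstr y' = z" by (rule obtain_bstr)
  obtain m u where m: "\<sigma> = (lookup m, bstr u)" "lexec p l y' m u"
    using WhileTrue.IH(1)[of l y'] WhileTrue.prems y' by auto
  obtain l' u' where l': "\<tau> = (lookup l', bstr u')" "lexec (While b p) m u l' u'"
    using WhileTrue.IH(2)[OF m(1)] by auto
  have "lexec (While b p) l y l' u'"
    by (rule lexec.WhileTrue[OF _ m(2) l'(2)]) (use WhileTrue y' in auto)
  with l'(1) show ?case by blast
next
  case (Seq p \<sigma> \<tau> q \<upsilon>)
  from Seq.IH(1)[OF Seq.prems] obtain m u where m: "\<tau> = (lookup m, bstr u)" "lexec p l y m u"
    by blast
  from Seq.IH(2)[OF m(1)] m(2) show ?case
    by (blast intro: lexec.Seq)
next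
  case (IfTrue b s y0 z p \<tau> q)
  obtain y' where y': "bstr y' = z" by (rule obtain_bstr)
  obtain l' u' where l': "\<tau> = (lookup l', bstr u')" "lexec p l y' l' u'"
    using IfTrue.IH[of l y'] IfTrue.prems y' by auto
  have "lexec (If b p q) l y l' u'"
    by (rule lexec.If[of b l y True y']) (use IfTrue y' l' in auto)
  with l'(1) show ?case by blast
next
  case (IfFalse b s y0 z q \<tau> p)
  obtain y' where y': "bstr y' = z" by (rule obtain_bstr)
  obtain l' u' where l': "\<tau> = (lookup l', bstr u')" "lexec q l y' l' u'"
    using IfFalse.IH[of l y'] IfFalse.prems y' by auto
  have "lexec (If b p q) l y l' u'"
    by (rule lexec.If[of b l y False y']) (use IfFalse y' l' in auto)
  with l'(1) show ?case by blast
qed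

lemma semidecidable_lexec: "semidecidable (\<lambda>(p, l, y, l', y'). lexec p l y l' y')"
\<comment> \<open>The rule for \<open>If\<close> is split by its truth value, as quantification is
  available over coded types only.\<close>
proof (rule semidecidable_inductive[where \<Phi> = "\<lambda>A (p, l, y, l', y').
    (p = Skip \<and> l' = l \<and> y' = y) \<or>
    (\<exists>i a n. p = Assign i a \<and> aval a (lookup l) (bstr y) = Some (n, bstr y') \<and> l' = (i, n) # l) \<or>
    (\<exists>b q. p = While b q \<and> bval b (lookup l) (bstr y) = Some (False, bstr y') \<and> l' = l) \<or>
    (\<exists>b q z m u. p = While b q \<and> bval b (lookup l) (bstr y) = Some (True, bstr z) \<and>
      (q, l, z, m, u) \<in> A \<and> (p, m, u, l', y') \<in> A) \<or>
    (\<exists>q r m u. p = Seq q r \<and> (q, l, y, m, u) \<in> A \<and> (r, m, u, l', y') \<in> A) \<or>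
    (\<exists>b q r z. p = If b q r \<and>
      (bval b (lookup l) (bstr y) = Some (True, bstr z) \<and> (q, l, z, l', y') \<in> A \<or>
       bval b (lookup l) (bstr y) = Some (False, bstr z) \<and> (r, l, z, l', y') \<in> A))"],
    goal_cases)
  case 1
  show ?case unfolding case_prod_beta
    by (rule semidecidable_intros semidecidable_comp5[OF semidecidable_aval] semidecidable_bval_eq
        semidecidable_if_decidable recursive_intros)+
next
  case (2 A B j)
  then show ?case unfolding case_prod_beta by blast
next
  case (3 A j)
  have A: "lexec p l y l' y'" if "(p, l, y, l', y') \<in> A" for p l y l' y'
    using "3"(2) that by auto
  from "3"(1) show ?case
    by (auto dest!: A intro: lexec.Skip lexec.Assign lexec.WhileFalse lexec.WhileTrue lexec.Seq
        lexec.If[where w = True, simplified] lexec.If[where w = False, simplified])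
next
  case (4 Q j)
  obtain p l y l' y' where j: "j = (p, l, y, l', y')" by (cases j)
  have "lexec p l y l' y' \<Longrightarrow> Q (p, l, y, l', y')"
  proof (induction rule: lexec.induct)
    case (Skip l y)
    show ?case by (intro "4"(1)[of "{}"]) auto
  next
    case (Assign a l y n y' i)
    then show ?case by (intro "4"(1)[of "{}"]) auto
  next
    case (WhileFalse b l y y' p)
    then show ?case by (intro "4"(1)[of "{}"]) auto
  next
    case (WhileTrue b l y z p m u l' y')
    then show ?case by (intro "4"(1)[of "{(p, l, z, m, u), (While b p, m, u, l', y')}"]) auto
  next
    case (Seq p l y m u q l' y')
    then show ?case by (intro "4"(1)[of "{(p, l, y, m, u), (q, m, u, l', y')}"]) auto
  next
    case (If b l y w z p q l' y')
    then show ?case by (intro "4"(1)[of "{(if w then p else q, l, z, l', y')}"]) auto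
  qed
  with "4"(2) show ?case by (simp add: j)
qed

text \<open>All quantifiers now range over coded types. The empty list is the all-zero memory, and
  the final position 0 says that all of \<open>y\<close> has been read.\<close>

lemma imp2_result_iff:
  "imp2_result (bstr w) (bstr x) \<longleftrightarrow>
   (\<exists>n y l. bstr w = tuple n (bstr y) \<and> lexec (dec n) [] y l 0 \<and> bstr x = out (lookup l))"
proof -
  have sentence: "sentence n = dec n" for n
    by (simp add: sentence_def dec_def enc_com_def)
  show ?thesis
  proof
    assume "imp2_result (bstr w) (bstr x)"
    then obtain n v s where w: "bstr w = tuple n v" and
      ex: "exec (dec n) (\<lambda>_. 0, v) (s, [])" and x: "bstr x = out s"
      unfolding imp2_result_def sentence by blast
    obtain y where y: "bstr y = v" by (rule obtain_bstr)
    with lexec_if_exec[OF ex, of "[]" y] obtain l y' where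
      "(s, []) = (lookup l, bstr y')" "lexec (dec n) [] y l y'" by auto
    moreover from this(1) have "y' = 0"
      by (metis bstr_eq_Nil_iff prod.inject)
    ultimately show "\<exists>n y l. bstr w = tuple n (bstr y) \<and> lexec (dec n) [] y l 0 \<and> bstr x = out (lookup l)"
      using w x y by auto
  next
    assume "\<exists>n y l. bstr w = tuple n (bstr y) \<and> lexec (dec n) [] y l 0 \<and> bstr x = out (lookup l)"
    then show "imp2_result (bstr w) (bstr x)"
      unfolding imp2_result_def sentence using exec_if_lexec by fastforce
  qed
qed

text \<open>Uniformization gives a function with some correct value wherever one exists; uniqueness
  of results makes its graph exactly that of \<open>IMP2\<close>.\<close>

lemma partial_computable_IMP2: "partial_computable IMP2"
proof -
  have "semidecidable (\<lambda>z. imp2_result (bstr (fst z)) (bstr (snd z)))"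
    unfolding imp2_result_iff
    by (rule semidecidable_intros semidecidable_comp3[OF semidecidable_tuple]
        semidecidable_comp5[OF semidecidable_lexec] semidecidable_comp2[OF semidecidable_out]
        recursive_intros)+
  then obtain f where f: "\<And>w x :: nat. reval f [enc w] (enc x) \<Longrightarrow> imp2_result (bstr w) (bstr x)"
    "\<And>w x :: nat. imp2_result (bstr w) (bstr x) \<Longrightarrow> \<exists>x :: nat. reval f [enc w] (enc x)"
    by (rule semidecidable_uniformization) blast
  have "imp2_result (bstr w) (bstr x) \<longleftrightarrow> reval f [w] x" for w x
    using f[of w] imp2_result_unique[of "bstr w"] by (metis bstr_eq_iff enc_nat_def)
  then show ?thesis
    unfolding partial_computable_def IMP2_eq_Some_iff by blast
qed

section \<open>Prefix-freeness of the domain of IMP2\<close>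

lemma aval_append:
  "aval a s y = Some (n, y') \<Longrightarrow> aval a s (y @ z) = Some (n, y' @ z)"
  by (induction a arbitrary: y n y') (fastforce simp: bind_eq_Some_conv split: list.splits)+

lemma bval_append:
  "bval b s y = Some (n, y') \<Longrightarrow> bval b s (y @ z) = Some (n, y' @ z)"
proof (induction b arbitrary: y n y')
  case (Equal a c)
  then obtain m u k where *: "aval a s y = Some (m, u)" "aval c s u = Some (k, y')" "n = (m = k)"
    by (auto simp: bind_eq_Some_conv)
  from *(3) aval_append[OF *(1), of z] aval_append[OF *(2), of z] show ?case by simp
next
  case (Less a c)
  then obtain m u k where *: "aval a s y = Some (m, u)" "aval c s u = Some (k, y')" "n = (m < k)"
    by (auto simp: bind_eq_Some_conv)
  from *(3) aval_append[OF *(1), of z] aval_append[OF *(2), of z] show ?case by simp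
qed (fastforce simp: bind_eq_Some_conv)+

text \<open>A halting run depends only on the bits it has read, so further bits at the end simply
  stay unread.\<close>

lemma exec_append:
  "exec p \<sigma> \<tau> \<Longrightarrow> exec p (fst \<sigma>, snd \<sigma> @ z) (fst \<tau>, snd \<tau> @ z)"
proof (induction rule: exec.induct)
  case (Assign a s y n y' i)
  then show ?case unfolding fst_conv snd_conv by (intro exec.Assign aval_append)
qed (auto intro: exec.intros bval_append)

lemma prefix_free_dom_IMP2: "prefix_free (dom IMP2)"
proof -
  have "p = q" if "imp2_result p x" "imp2_result q x'" "prefix p q" for p q x x'
  proof -
    from that obtain n y s m u s' v where p: "p = tuple n y" "exec (sentence n) (\<lambda>_. 0, y) (s, [])"
      and q: "q = tuple m u" "exec (sentence m) (\<lambda>_. 0, u) (s', [])" and "q = p @ v"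
      unfolding imp2_result_def prefix_def by auto
    then have "selfdelim m @ u = selfdelim n @ (y @ v)"
      by (simp add: tuple_def)
    from selfdelim_prefix_inj[OF this] have "m = n" "u = y @ v" by simp_all
    \<comment> \<open>The run on \<open>y\<close> followed by \<open>v\<close> stops with
      \<open>v\<close> unread, whereas \<open>q\<close> is accepted with nothing unread; determinism
      identifies the two runs.\<close>
    with exec_append[OF p(2), of v] q(2) have "v = []"
      by (auto dest: exec_deterministic)
    with \<open>q = p @ v\<close> show ?thesis by simp
  qed
  then show ?thesis
    unfolding prefix_free_def strict_prefix_def by (metis IMP2_eq_Some_iff domD)
qed


section \<open>Compiling recursive functions to IMP2\<close>

lemma reval_Zero_iff: "reval Zero xs y \<longleftrightarrow> y = 0"
  by (auto elim: reval_elims(1) intro: reval.intros)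

lemma reval_Succ_iff: "reval Succ xs y \<longleftrightarrow> (\<exists>x. xs = [x] \<and> y = Suc x)"
  by (auto elim: reval_elims(2) intro: reval.intros)

lemma reval_Proj_iff: "reval (Proj i) xs y \<longleftrightarrow> i < length xs \<and> y = xs ! i"
  by (auto elim: reval_elims(3) intro: reval.intros)

lemma reval_Comp_iff:
  "reval (Comp f gs) xs z \<longleftrightarrow> (\<exists>ys. list_all2 (\<lambda>g y. reval g xs y) gs ys \<and> reval f ys z)"
  by (auto elim: reval_elims(4) intro: reval.intros)

lemma reval_Minimize_iff:
  "reval (Minimize f) xs n \<longleftrightarrow> reval f (n # xs) 0 \<and> (\<forall>m<n. \<exists>y. reval f (m # xs) (Suc y))"
  by (auto elim: reval_elims(7) intro: reval.intros)

text \<open>The course of values \<open>c\<close> is what a search can guess as a list, and what the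
  invariant of the compiled loop refers to.\<close>

lemma reval_PrimRec_iff:
  "reval (PrimRec f g) (n # xs) y \<longleftrightarrow>
   (\<exists>c. reval f xs (c 0) \<and> (\<forall>i<n. reval g (i # c i # xs) (c (Suc i))) \<and> c n = y)"
proof
  assume "reval (PrimRec f g) (n # xs) y"
  then show "\<exists>c. reval f xs (c 0) \<and> (\<forall>i<n. reval g (i # c i # xs) (c (Suc i))) \<and> c n = y"
  proof (induction n arbitrary: y)
    case 0
    then show ?case by (auto elim!: reval_elims(5))
  next
    case (Suc n)
    then obtain z where z: "reval (PrimRec f g) (n # xs) z" "reval g (n # z # xs) y"
      by (auto elim: reval_elims(6))
    from Suc.IH[OF z(1)] obtain c where
      "reval f xs (c 0)" "\<forall>i<n. reval g (i # c i # xs) (c (Suc i))" "c n = z"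
      by blast
    with z(2) show ?case
      by (intro exI[of _ "c(Suc n := y)"]) (auto simp: less_Suc_eq)
  qed
next
  assume "\<exists>c. reval f xs (c 0) \<and> (\<forall>i<n. reval g (i # c i # xs) (c (Suc i))) \<and> c n = y"
  then obtain c where "reval f xs (c 0)" "\<forall>i<n. reval g (i # c i # xs) (c (Suc i))" "c n = y"
    by blast
  then show "reval (PrimRec f g) (n # xs) y"
    by (induction n arbitrary: y) (auto intro: reval.intros)
qed

text \<open>The term \<open>f\<close> is fixed, so structural induction on it suffices. For
  primitive recursion the intermediate values are guessed as a list \<open>cs\<close> and read off
  by \<open>hd (drop i cs)\<close>.\<close>

lemma semidecidable_reval: "semidecidable (\<lambda>(xs, y). reval f xs y)"
proof (induction f)
  case Zero
  show ?case unfolding case_prod_beta reval_Zero_iff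
    by (rule semidecidable_if_decidable recursive_intros)+
next
  case Succ
  show ?case unfolding case_prod_beta reval_Succ_iff
    by (rule semidecidable_intros semidecidable_if_decidable recursive_intros)+
next
  case (Proj i)
  have *: "reval (Proj i) xs y \<longleftrightarrow> drop i xs \<noteq> [] \<and> y = hd (drop i xs)" for xs y
    by (auto simp: reval_Proj_iff hd_drop_conv_nth)
  show ?case unfolding case_prod_beta *
    by (rule semidecidable_if_decidable recursive_intros)+
next
  case (Comp f gs)
  have *: "semidecidable (\<lambda>(xs, ys). list_all2 (\<lambda>g y. reval g xs y) gs ys)"
    using Comp.IH(2)
  proof (induction gs)
    case Nil
    show ?case unfolding case_prod_beta list_all2_Nil
      by (rule semidecidable_if_decidable recursive_intros)+
  next
    case (Cons g gs)
    from Cons.prems have g: "semidecidable (\<lambda>(xs, y). reval g xs y)" by simp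
    from Cons have gs: "semidecidable (\<lambda>(xs, ys). list_all2 (\<lambda>g y. reval g xs y) gs ys)" by simp
    show ?case unfolding case_prod_beta list_all2_Cons1
      by (rule semidecidable_intros semidecidable_comp2[OF g] semidecidable_comp2[OF gs]
          semidecidable_if_decidable recursive_intros)+
  qed
  show ?case unfolding case_prod_beta reval_Comp_iff
    by (rule semidecidable_intros semidecidable_comp2[OF *] semidecidable_comp2[OF Comp.IH(1)]
        recursive_intros)+
next
  case (PrimRec f g)
  have *: "reval (PrimRec f g) xs y \<longleftrightarrow>
      (\<exists>n zs cs. xs = n # zs \<and> reval f zs (hd cs) \<and>
        (\<forall>i<n. reval g (i # hd (drop i cs) # zs) (hd (drop (Suc i) cs))) \<and> hd (drop n cs) = y)"
    (is "?lhs \<longleftrightarrow> ?rhs") for xs y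
  proof
    assume ?lhs
    then obtain n zs where xs: "xs = n # zs"
      by (cases rule: reval.cases) auto
    with \<open>?lhs\<close> obtain c where c: "reval f zs (c 0)"
      "\<forall>i<n. reval g (i # c i # zs) (c (Suc i))" "c n = y"
      by (auto simp: reval_PrimRec_iff)
    have "hd (drop i (map c [0..<Suc n])) = c i" if "i \<le> n" for i
      using that by (subst hd_drop_conv_nth) (simp_all add: nth_append del: upt_Suc)
    with xs c show ?rhs
      by - (rule exI[of _ n], rule exI[of _ zs], rule exI[of _ "map c [0..<Suc n]"],
        simp add: hd_map del: upt_Suc)
  next
    assume ?rhs
    then obtain n zs cs where "xs = n # zs" "reval f zs (hd cs)"
        "\<forall>i<n. reval g (i # hd (drop i cs) # zs) (hd (drop (Suc i) cs))" "hd (drop n cs) = y"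
      by blast
    then show ?lhs
      unfolding reval_PrimRec_iff by (auto simp: reval_PrimRec_iff intro!: exI[of _ "\<lambda>i. hd (drop i cs)"])
  qed
  show ?case unfolding case_prod_beta *
    by (rule semidecidable_intros semidecidable_comp2[OF PrimRec.IH(1)]
        semidecidable_comp2[OF PrimRec.IH(2)] semidecidable_if_decidable recursive_intros)+
next
  case (Minimize f)
  show ?case unfolding case_prod_beta reval_Minimize_iff
    by (rule semidecidable_intros semidecidable_comp2[OF Minimize.IH] recursive_intros)+
qed

text \<open>It takes compiled functions instead of terms, so that \<open>compile\<close> can recurse
  through the argument list of \<open>Comp\<close>. The results go to consecutive locations from
  \<open>r\<close> on.\<close>

primrec eval_args ::
  "(nat list \<Rightarrow> nat \<Rightarrow> nat \<Rightarrow> com) list \<Rightarrow> nat list \<Rightarrow> nat \<Rightarrow> nat \<Rightarrow> com" where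
  "eval_args [] ks r n = Skip"
| "eval_args (c # cs) ks r n = Seq (c ks r n) (eval_args cs ks (Suc r) n)"

text \<open>
  The arguments are in the locations \<open>ks\<close>, the result goes to location \<open>r\<close>, and the locations from
  \<open>n\<close> on are scratch space.
\<close>

primrec compile :: "recf \<Rightarrow> nat list \<Rightarrow> nat \<Rightarrow> nat \<Rightarrow> com" where
  "compile Zero ks r n = Assign r (Num 0)"
| "compile Succ ks r n = Assign r (Plus (Loc (hd ks)) (Num 1))"
| "compile (Proj i) ks r n = Assign r (Loc (ks ! i))"
| "compile (Comp f gs) ks r n =
     Seq (eval_args (map (\<lambda>g. compile g) gs) ks n (n + length gs))
       (compile f [n..<n + length gs] r (n + length gs))"
| "compile (PrimRec f g) ks r n =
     Seq (Assign n (Num 0)) (Seq (compile f (tl ks) (n + 1) (n + 3))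
       (Seq (While (Less (Loc n) (Loc (hd ks)))
          (Seq (compile g (n # (n + 1) # tl ks) (n + 2) (n + 3))
            (Seq (Assign (n + 1) (Loc (n + 2))) (Assign n (Plus (Loc n) (Num 1))))))
        (Assign r (Loc (n + 1)))))"
| "compile (Minimize f) ks r n =
     Seq (Assign n (Num 0)) (Seq (compile f (n # ks) (n + 1) (n + 2))
       (Seq (While (Less (Num 0) (Loc (n + 1)))
          (Seq (Assign n (Plus (Loc n) (Num 1))) (compile f (n # ks) (n + 1) (n + 2))))
        (Assign r (Loc n))))"

text \<open>Nothing is assumed about the contents of scratch locations, since compiled code is run
  repeatedly inside loops. The unread input \<open>z\<close> passes through untouched.\<close>

definition implements :: "(nat list \<Rightarrow> nat \<Rightarrow> nat \<Rightarrow> com) \<Rightarrow> recf \<Rightarrow> bool" where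
  "implements c f \<longleftrightarrow> (\<forall>y ks r n s z. reval f (map s ks) y \<longrightarrow> (\<forall>k\<in>set ks. k < n) \<longrightarrow> r < n \<longrightarrow>
     (\<exists>s'. exec (c ks r n) (s, z) (s', z) \<and> s' r = y \<and> (\<forall>i<n. i \<noteq> r \<longrightarrow> s' i = s i)))"

lemma implementsE:
  assumes "implements c f" "reval f xs y" "map s ks = xs" "\<forall>k\<in>set ks. k < n" "r < n"
  obtains s' where "exec (c ks r n) (s, z) (s', z)" "s' r = y" "\<And>i. i < n \<Longrightarrow> i \<noteq> r \<Longrightarrow> s' i = s i"
  using assms unfolding implements_def by metis

text \<open>All arguments lie below \<open>r\<close> and the scratch space above the results, so no
  call disturbs the arguments or an earlier result.\<close>

lemma exec_eval_args:
  assumes "list_all2 implements cs gs" "list_all2 (\<lambda>g y. reval g xs y) gs ys"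
    "map s ks = xs" "\<forall>k\<in>set ks. k < r" "r + length gs \<le> n"
  shows "\<exists>s'. exec (eval_args cs ks r n) (s, z) (s', z) \<and> map s' [r..<r + length gs] = ys \<and>
    (\<forall>i<r. s' i = s i)"
  using assms
proof (induction cs arbitrary: gs ys s r)
  case Nil
  then show ?case by (auto intro: exec.Skip)
next
  case (Cons c cs)
  from Cons.prems(1,2) obtain g gs' y ys' where gs: "gs = g # gs'" "implements c g"
    "list_all2 implements cs gs'" and ys: "ys = y # ys'" "reval g xs y"
    "list_all2 (\<lambda>g y. reval g xs y) gs' ys'"
    by (auto simp: list_all2_Cons1)
  have "\<forall>k\<in>set ks. k < n" "r < n" using Cons.prems gs(1) by auto
  from implementsE[OF gs(2) ys(2) Cons.prems(3) this] obtain t where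
    t: "exec (c ks r n) (s, z) (t, z)" "t r = y" "\<And>i. i < n \<Longrightarrow> i \<noteq> r \<Longrightarrow> t i = s i"
    by metis
  have "map t ks = xs"
    using Cons.prems(3-5) gs(1) t(3) by (auto intro!: map_cong)
  with Cons.IH[OF gs(3) ys(3), of t "Suc r"] Cons.prems gs(1) obtain s' where
    s': "exec (eval_args cs ks (Suc r) n) (t, z) (s', z)"
    "map s' [Suc r..<Suc r + length gs'] = ys'" "\<forall>i<Suc r. s' i = t i"
    by (force simp: less_Suc_eq)
  have "map s' [r..<r + length gs] = ys"
    using s'(2,3) t(2) gs(1) ys(1) by (simp add: upt_conv_Cons del: upt_Suc)
  with s' t Cons.prems(5) gs(1) show ?case
    by (intro exI[of _ s']) (auto intro: exec.Seq)
qed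

lemma exec_Assign: "aval a s y = Some (n, y) \<Longrightarrow> s' = s(i := n) \<Longrightarrow> exec (Assign i a) (s, y) (s', y)"
  by (simp add: exec.Assign)

lemma implements_compile: "implements (compile f) f"
proof (induction f)
  case Zero
  show ?case unfolding implements_def
    by (auto simp: reval_Zero_iff intro!: exec_Assign exI)
next
  case Succ
  show ?case unfolding implements_def
    by (auto simp: reval_Succ_iff intro!: exec_Assign exI)
next
  case (Proj i)
  show ?case unfolding implements_def
    by (auto simp: reval_Proj_iff intro!: exec_Assign exI)
next
  case (Comp f gs)
  show ?case unfolding implements_def
  proof (intro allI impI)
    fix y r n s z and ks :: "nat list"
    assume "reval (Comp f gs) (map s ks) y" and ks: "\<forall>k\<in>set ks. k < n" and r: "r < n"
    then obtain ys where ys: "list_all2 (\<lambda>g. reval g (map s ks)) gs ys" "reval f ys y"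
      by (auto simp: reval_Comp_iff)
    have "list_all2 implements (map (\<lambda>g. compile g) gs) gs"
      using Comp.IH(2) by (auto simp: list_all2_conv_all_nth)
    from exec_eval_args[OF this ys(1) _ ks order.refl, of s z] obtain t where
      t: "exec (eval_args (map (\<lambda>g. compile g) gs) ks n (n + length gs)) (s, z) (t, z)"
      "map t [n..<n + length gs] = ys" "\<forall>i<n. t i = s i"
      by metis
    from r have "\<forall>k\<in>set [n..<n + length gs]. k < n + length gs" "r < n + length gs" by auto
    from implementsE[OF Comp.IH(1) ys(2) t(2) this] obtain s' where
      "exec (compile f [n..<n + length gs] r (n + length gs)) (t, z) (s', z)" "s' r = y"
      "\<And>i. i < n + length gs \<Longrightarrow> i \<noteq> r \<Longrightarrow> s' i = t i"
      by metis
    with t show "\<exists>s'. exec (compile (Comp f gs) ks r n) (s, z) (s', z) \<and> s' r = y \<and>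
        (\<forall>i<n. i \<noteq> r \<longrightarrow> s' i = s i)"
      by (intro exI[of _ s']) (auto intro: exec.Seq)
  qed
next
  case (PrimRec f g)
  show ?case unfolding implements_def
  proof (intro allI impI)
    fix y r n s z and ks :: "nat list"
    assume *: "reval (PrimRec f g) (map s ks) y" and ks: "\<forall>k\<in>set ks. k < n" and r: "r < n"
    from * obtain k ks' where ks_eq: "ks = k # ks'"
      by (cases rule: reval.cases) auto
    with * obtain c where c: "reval f (map s ks') (c 0)"
      "\<forall>i<s k. reval g (i # c i # map s ks') (c (Suc i))" "c (s k) = y"
      by (auto simp: reval_PrimRec_iff)
    \<comment> \<open>Location \<open>n\<close> is the counter, \<open>n + 1\<close> holds the
      current value, \<open>n + 2\<close> receives the next one, and scratch space starts at
      \<open>n + 3\<close>.\<close>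
    define body where "body = Seq (compile g (n # (n + 1) # ks') (n + 2) (n + 3))
      (Seq (Assign (n + 1) (Loc (n + 2))) (Assign n (Plus (Loc n) (Num 1))))"
    define w where "w = While (Less (Loc n) (Loc k)) body"
    \<comment> \<open>The invariant is that \<open>n + 1\<close> holds \<open>c i\<close> when the
      counter is \<open>i\<close>; the induction goes down from the final count
      \<open>s k\<close>.\<close>
    have loop: "\<exists>s'. exec w (t, z) (s', z) \<and> s' (n + 1) = c (s k) \<and> (\<forall>i<n. s' i = s i)"
      if "i \<le> s k" "t n = i" "t (n + 1) = c i" "\<forall>j<n. t j = s j" for t i
      using that
    proof (induction i arbitrary: t rule: inc_induct)
      case base
      then have "exec w (t, z) (t, z)"
        unfolding w_def using ks ks_eq by (intro exec.WhileFalse) simp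
      with base show ?case by auto
    next
      case (step i)
      have m: "map t (n # (n + 1) # ks') = i # c i # map s ks'"
        using step.prems ks ks_eq by auto
      have b: "\<forall>k\<in>set (n # (n + 1) # ks'). k < n + 3" "n + 2 < n + 3"
        using ks ks_eq by auto
      obtain u where u: "exec (compile g (n # (n + 1) # ks') (n + 2) (n + 3)) (t, z) (u, z)"
        "u (n + 2) = c (Suc i)" "\<And>j. j < n + 3 \<Longrightarrow> j \<noteq> n + 2 \<Longrightarrow> u j = t j"
        using implementsE[OF PrimRec.IH(2) c(2)[rule_format, OF step.hyps(2)] m b] by metis
      define v where "v = u(n + 1 := c (Suc i), n := Suc i)"
      have v: "v n = Suc i" "v (n + 1) = c (Suc i)" "\<forall>j<n. v j = s j"
        using u(3) step.prems by (auto simp: v_def)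
      have "exec (Seq (Assign (n + 1) (Loc (n + 2))) (Assign n (Plus (Loc n) (Num 1)))) (u, z) (v, z)"
        by (rule exec.Seq; rule exec_Assign) (use u step.prems in \<open>simp_all add: v_def\<close>)
      with u(1) have body: "exec body (t, z) (v, z)"
        unfolding body_def by (rule exec.Seq)
      obtain s' where s': "exec w (v, z) (s', z)" "s' (n + 1) = c (s k)" "\<forall>i<n. s' i = s i"
        using step.IH[OF v] by blast
      have "exec w (t, z) (s', z)"
        unfolding w_def
        by (rule exec.WhileTrue[OF _ body])
          (use s'(1) step.prems step.hyps ks ks_eq in \<open>simp_all add: w_def\<close>)
      with s' show ?case by blast
    qed
    have m: "map (s(n := 0)) ks' = map s ks'" and b: "\<forall>k\<in>set ks'. k < n + 3" "n + 1 < n + 3"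
      using ks ks_eq by auto
    obtain t where t: "exec (compile f ks' (n + 1) (n + 3)) (s(n := 0), z) (t, z)"
      "t (n + 1) = c 0" "\<And>j. j < n + 3 \<Longrightarrow> j \<noteq> n + 1 \<Longrightarrow> t j = (s(n := 0)) j"
      using implementsE[OF PrimRec.IH(1) c(1) m b] by metis
    obtain s' where s': "exec w (t, z) (s', z)" "s' (n + 1) = y" "\<forall>i<n. s' i = s i"
      using loop[of 0 t] t(2,3) c(3) by auto
    have "exec (compile (PrimRec f g) ks r n) (s, z) (s'(r := y), z)"
      unfolding compile.simps ks_eq list.sel body_def[symmetric] w_def[symmetric]
      by (intro exec.Seq[OF exec_Assign exec.Seq[OF t(1) exec.Seq[OF s'(1) exec_Assign]]])
        (use s'(2) in simp_all)
    with s'(3) show "\<exists>s'. exec (compile (PrimRec f g) ks r n) (s, z) (s', z) \<and> s' r = y \<and>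
        (\<forall>i<n. i \<noteq> r \<longrightarrow> s' i = s i)"
      by (intro exI[of _ "s'(r := y)"]) auto
  qed
next
  case (Minimize f)
  show ?case unfolding implements_def
  proof (intro allI impI)
    fix y r n s z and ks :: "nat list"
    assume "reval (Minimize f) (map s ks) y" and ks: "\<forall>k\<in>set ks. k < n" and r: "r < n"
    then have y: "reval f (y # map s ks) 0"
      and less: "\<forall>m<y. \<exists>v. reval f (m # map s ks) (Suc v)"
      by (auto simp: reval_Minimize_iff)
    define call where "call = compile f (n # ks) (n + 1) (n + 2)"
    define w where
      "w = While (Less (Num 0) (Loc (n + 1))) (Seq (Assign n (Plus (Loc n) (Num 1))) call)"
    \<comment> \<open>The invariant is stated before the call, not at the loop test, which treats
      the call ahead of the loop and the call ending each round alike.\<close>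
    have loop: "\<exists>s'. exec (Seq call w) (t, z) (s', z) \<and> s' n = y \<and> (\<forall>i<n. s' i = s i)"
      if "i \<le> y" "t n = i" "\<forall>j<n. t j = s j" for t i
      using that
    proof (induction i arbitrary: t rule: inc_induct)
      case base
      have m: "map t (n # ks) = y # map s ks" and b: "\<forall>k\<in>set (n # ks). k < n + 2" "n + 1 < n + 2"
        using base ks by auto
      obtain u where u: "exec call (t, z) (u, z)" "u (n + 1) = 0"
        "\<And>j. j < n + 2 \<Longrightarrow> j \<noteq> n + 1 \<Longrightarrow> u j = t j"
        using implementsE[OF Minimize.IH y m b] unfolding call_def by metis
      have "exec w (u, z) (u, z)"
        unfolding w_def using u(2) by (intro exec.WhileFalse) simp
      with u base show ?case
        by (intro exI[of _ u]) (auto intro: exec.Seq)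
    next
      case (step i)
      from less step.hyps(2) obtain v where v: "reval f (i # map s ks) (Suc v)" by blast
      have m: "map t (n # ks) = i # map s ks" and b: "\<forall>k\<in>set (n # ks). k < n + 2" "n + 1 < n + 2"
        using step.prems ks by auto
      obtain u where u: "exec call (t, z) (u, z)" "u (n + 1) = Suc v"
        "\<And>j. j < n + 2 \<Longrightarrow> j \<noteq> n + 1 \<Longrightarrow> u j = t j"
        using implementsE[OF Minimize.IH v m b] unfolding call_def by metis
      have v': "(u(n := Suc i)) n = Suc i" "\<forall>j<n. (u(n := Suc i)) j = s j"
        using u(3) step.prems by auto
      obtain s' where s': "exec (Seq call w) (u(n := Suc i), z) (s', z)" "s' n = y" "\<forall>i<n. s' i = s i"
        using step.IH[OF v'] by blast
      \<comment> \<open>The run is cut after the call, so that increment and call can be joined into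
        one loop body.\<close>
      from s'(1) obtain \<sigma> where \<sigma>: "exec call (u(n := Suc i), z) \<sigma>" "exec w \<sigma> (s', z)"
        by (rule exec_elims(3))
      have "exec (Seq (Assign n (Plus (Loc n) (Num 1))) call) (u, z) \<sigma>"
        by (rule exec.Seq[OF exec_Assign \<sigma>(1)]) (use u(3) step.prems in simp_all)
      with \<sigma>(2) u(2) have "exec w (u, z) (s', z)"
        unfolding w_def by (intro exec.WhileTrue) simp_all
      with u(1) s' show ?case by (blast intro: exec.Seq)
    qed
    obtain s' where s': "exec (Seq call w) (s(n := 0), z) (s', z)" "s' n = y" "\<forall>i<n. s' i = s i"
      using loop[of 0 "s(n := 0)"] by auto
    from s'(1) obtain \<sigma> where \<sigma>: "exec call (s(n := 0), z) \<sigma>" "exec w \<sigma> (s', z)"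
      by (rule exec_elims(3))
    have "exec (compile (Minimize f) ks r n) (s, z) (s'(r := y), z)"
      unfolding compile.simps call_def[symmetric] w_def[symmetric]
      by (intro exec.Seq[OF exec_Assign exec.Seq[OF \<sigma>(1) exec.Seq[OF \<sigma>(2) exec_Assign]]])
        (use s'(2) in simp_all)
    with s'(3) show "\<exists>s'. exec (compile (Minimize f) ks r n) (s, z) (s', z) \<and> s' r = y \<and>
        (\<forall>i<n. i \<noteq> r \<longrightarrow> s' i = s i)"
      by (intro exI[of _ "s'(r := y)"]) auto
  qed
qed

text \<open>Leftover scratch values would spoil the output. Locations from this bound on are never
  written, so clearing finitely many suffices.\<close>

primrec write_bound :: "com \<Rightarrow> nat" where
  "write_bound Skip = 0"
| "write_bound (Assign i a) = Suc i"
| "write_bound (While b p) = write_bound p"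
| "write_bound (Seq p q) = max (write_bound p) (write_bound q)"
| "write_bound (If b p q) = max (write_bound p) (write_bound q)"

lemma exec_unchanged: "exec p \<sigma> \<tau> \<Longrightarrow> write_bound p \<le> i \<Longrightarrow> fst \<tau> i = fst \<sigma> i"
  by (induction rule: exec.induct) auto

text \<open>Location 0 is spared, as it holds the result.\<close>

primrec clear :: "nat \<Rightarrow> com" where
  "clear 0 = Skip"
| "clear (Suc n) = Seq (Assign (Suc n) (Num 0)) (clear n)"

lemma exec_clear: "exec (clear n) (s, y) (\<lambda>i. if 1 \<le> i \<and> i \<le> n then 0 else s i, y)"
proof (induction n arbitrary: s)
  case 0
  have "(\<lambda>i. if 1 \<le> i \<and> i \<le> 0 then 0 else s i) = s" by auto
  then show ?case by (simp add: exec.Skip)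
next
  case (Suc n)
  have "(\<lambda>i. if 1 \<le> i \<and> i \<le> n then 0 else (s(Suc n := 0)) i) =
      (\<lambda>i. if 1 \<le> i \<and> i \<le> Suc n then 0 else s i)" by (auto simp: le_Suc_eq)
  with Suc[of "s(Suc n := 0)"] show ?case
    by (auto intro: exec.Seq[OF exec_Assign])
qed


section \<open>Simulation of prefix machines\<close>

text \<open>
  The search function behind the simulation of a prefix machine computed by \<open>f\<close>: on the string read
  so far it asks for another bit (value 0) or delivers an output (shifted by 1), as soon as it has
  found some program extending that string.
\<close>

definition next_action :: "recf \<Rightarrow> nat \<Rightarrow> nat \<Rightarrow> bool" where
  "next_action f m r \<longleftrightarrow> (\<exists>p v q. reval f [p] v \<and> bstr p = bstr m @ bstr q \<and>
     (q = 0 \<and> r = Suc v \<or> q \<noteq> 0 \<and> r = 0))"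

lemma semidecidable_next_action: "semidecidable (\<lambda>z. next_action f (fst z) (snd z))"
  unfolding next_action_def
  by (rule semidecidable_intros semidecidable_comp2[OF semidecidable_reval]
      semidecidable_comp3[OF semidecidable_append] semidecidable_if_decidable recursive_intros)+

text \<open>Location 1 holds the position of the string read so far, initially 0 for the empty
  string, and location 0 the reply of \<open>h\<close>. The assignment computes the position of that
  string with the next bit appended.\<close>

definition read_loop :: "recf \<Rightarrow> com" where
  "read_loop h = Seq (compile h [1] 0 2) (While (Equal (Loc 0) (Num 0))
     (Seq (Assign 1 (Plus (Plus (Times (Num 2) (Loc 1)) (Num 1)) ReadBit)) (compile h [1] 0 2)))"

text \<open>Induction on the unread rest \<open>t\<close>. Apart from location 1 the memory is
  arbitrary, so the hypothesis also covers re-entering the loop with used scratch space.\<close>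

lemma exec_read_loop:
  assumes h: "\<And>m r. reval h [m] r \<Longrightarrow> next_action f m r"
    "\<And>m r. next_action f m r \<Longrightarrow> \<exists>r. reval h [m] r"
    and prefix_free: "\<And>p q v u. reval f [p] v \<Longrightarrow> reval f [q] u \<Longrightarrow> prefix (bstr p) (bstr q) \<Longrightarrow> p = q"
    and v: "reval f [p] v"
    and "bstr p = bstr (s 1) @ t"
  shows "\<exists>s'. exec (read_loop h) (s, t) (s', []) \<and> s' 0 = Suc v"
  using assms(5)
proof (induction t arbitrary: s)
  case Nil
  then have s1: "s 1 = p" by simp
  \<comment> \<open>\<open>p\<close> with the empty extension guarantees that the search ends,
    though not yet that it finds \<open>p\<close>.\<close>
  obtain r where r: "reval h [p] r"
    using h(2)[of p "Suc v"] v unfolding next_action_def by force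
  then obtain q u w where q: "reval f [q] u" "bstr q = bstr p @ bstr w"
    "w = 0 \<and> r = Suc u \<or> w \<noteq> 0 \<and> r = 0"
    using h(1) unfolding next_action_def by blast
  \<comment> \<open>Any other program found here would properly extend the program
    \<open>p\<close>.\<close>
  from q(2) have "p = q"
    by (intro prefix_free[OF v q(1)]) simp
  with q v have "r = Suc v"
    by (auto dest: reval_deterministic)
  from r s1 obtain s' where s': "exec (compile h [1] 0 2) (s, []) (s', [])" "s' 0 = r"
    using implementsE[OF implements_compile r, where s = s and ks = "[1]" and n = 2 and r = 0 and z = "[]"]
    by auto
  have "exec (While (Equal (Loc 0) (Num 0))
     (Seq (Assign 1 (Plus (Plus (Times (Num 2) (Loc 1)) (Num 1)) ReadBit)) (compile h [1] 0 2)))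
     (s', []) (s', [])"
    by (rule exec.WhileFalse) (use s'(2) \<open>r = Suc v\<close> in simp)
  with s' \<open>r = Suc v\<close> show ?case
    unfolding read_loop_def by (blast intro: exec.Seq)
next
  case (Cons b t)
  define W where "W = While (Equal (Loc 0) (Num 0))
     (Seq (Assign 1 (Plus (Plus (Times (Num 2) (Loc 1)) (Num 1)) ReadBit)) (compile h [1] 0 2))"
  \<comment> \<open>\<open>p\<close> extends the string read so far by \<open>b # t\<close>, which
    guarantees that the search ends.\<close>
  obtain q0 where q0: "bstr q0 = b # t" by (rule obtain_bstr)
  then have "q0 \<noteq> 0" by (metis bstr.simps(1) list.distinct(1))
  with q0 Cons.prems have "next_action f (s 1) 0"
    unfolding next_action_def using v
    by - (rule exI[of _ p], rule exI[of _ v], rule exI[of _ q0], auto)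
  then obtain r where r: "reval h [s 1] r"
    using h(2) by blast
  then obtain q u w where q: "reval f [q] u" "bstr q = bstr (s 1) @ bstr w"
    "w = 0 \<and> r = Suc u \<or> w \<noteq> 0 \<and> r = 0"
    using h(1) unfolding next_action_def by blast
  \<comment> \<open>A nonzero reply would make the string read so far a program, and it is a proper
    prefix of \<open>p\<close>.\<close>
  have "r = 0"
  proof (rule ccontr)
    assume "r \<noteq> 0"
    with q have "q = s 1" by auto
    with Cons.prems have "q = p"
      by (intro prefix_free[OF q(1) v]) simp
    with \<open>q = s 1\<close> Cons.prems show False by simp
  qed
  obtain s' where s': "exec (compile h [1] 0 2) (s, b # t) (s', b # t)" "s' 0 = r"
    and unchanged: "\<And>i. i < 2 \<Longrightarrow> i \<noteq> 0 \<Longrightarrow> s' i = s i"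
    using implementsE[OF implements_compile r, where s = s and ks = "[1]" and n = 2 and r = 0 and z = "b # t"]
    by auto
  from unchanged[of 1] have s'1: "s' 1 = s 1" by simp
  define s2 where "s2 = s'(1 := Suc (2 * s 1 + of_bool b))"
  have "bstr p = bstr (s2 1) @ t"
    using Cons.prems by (cases b) (simp_all add: s2_def)
  from Cons.IH[of s2, OF this] obtain s3 where s3: "exec (read_loop h) (s2, t) (s3, [])" "s3 0 = Suc v"
    by blast
  from s3(1) obtain \<sigma> where \<sigma>: "exec (compile h [1] 0 2) (s2, t) \<sigma>" "exec W \<sigma> (s3, [])"
    unfolding read_loop_def W_def by (rule exec_elims(3))
  have "exec (Assign 1 (Plus (Plus (Times (Num 2) (Loc 1)) (Num 1)) ReadBit)) (s', b # t) (s2, t)"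
    unfolding s2_def by (rule exec.Assign) (use s'1 in simp)
  then have "exec (Seq (Assign 1 (Plus (Plus (Times (Num 2) (Loc 1)) (Num 1)) ReadBit))
      (compile h [1] 0 2)) (s', b # t) \<sigma>"
    using \<sigma>(1) by (rule exec.Seq)
  with \<sigma>(2) have "exec W (s', b # t) (s3, [])"
    unfolding W_def by (intro exec.WhileTrue) (use s'(2) \<open>r = 0\<close> in simp_all)
  with s'(1) s3(2) show ?case
    unfolding read_loop_def W_def[symmetric] by (blast intro: exec.Seq)
qed

lemma prefix_machine_simulation:
  assumes "prefix_machine G"
  obtains n where "\<And>p x. G p = Some x \<Longrightarrow> IMP2 (tuple n p) = Some x"
proof -
  from assms obtain f where f: "\<And>m n. G (bstr m) = Some (bstr n) \<longleftrightarrow> reval f [m] n"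
    and pf: "prefix_free (dom G)"
    unfolding prefix_machine_def partial_computable_def by blast
  obtain h where h: "\<And>m r :: nat. reval h [enc m] (enc r) \<Longrightarrow> next_action f m r"
    "\<And>m r. next_action f m r \<Longrightarrow> \<exists>r :: nat. reval h [enc m] (enc r)"
    using semidecidable_uniformization[OF semidecidable_next_action] by metis
  have prefix_eq: "p = q" if "reval f [p] v" "reval f [q] u" "prefix (bstr p) (bstr q)" for p q v u
  proof -
    have "bstr p \<in> dom G" "bstr q \<in> dom G"
      using that(1,2) f by blast+
    with pf that(3) have "bstr p = bstr q"
      unfolding prefix_free_def strict_prefix_def by blast
    then show ?thesis by simp
  qed
  \<comment> \<open>The subtraction undoes the shift by 1 of the reply; clearing then leaves
    location 0 as the only contribution to the output.\<close>
  define P where "P = Seq (read_loop h) (Seq (Assign 0 (Minus (Loc 0) (Num 1)))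
    (clear (write_bound (read_loop h))))"
  obtain n where n: "sentence n = P"
    using bij_sentence by (metis bij_pointE)
  have "IMP2 (tuple n w) = Some x" if "G w = Some x" for w x
  proof -
    obtain p v where p: "bstr p = w" "bstr v = x"
      by (metis obtain_bstr)
    with that f have v: "reval f [p] v" by blast
    have "\<exists>s. exec (read_loop h) (\<lambda>_. 0, w) (s, []) \<and> s 0 = Suc v"
      by (rule exec_read_loop[where f = f and p = p])
        (use h prefix_eq v p(1) in \<open>simp_all only: enc_nat_def bstr.simps append_Nil\<close>)
    then obtain s where s: "exec (read_loop h) (\<lambda>_. 0, w) (s, [])" "s 0 = Suc v" by blast
    let ?N = "write_bound (read_loop h)"
    let ?s = "\<lambda>i. if 1 \<le> i \<and> i \<le> ?N then 0 else (s(0 := v)) i"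
    \<comment> \<open>Locations up to \<open>?N\<close> have been cleared, and those beyond still
      have their initial value 0.\<close>
    have zero: "?s i = 0" if "1 \<le> i" for i
      using that exec_unchanged[OF s(1), of i] by auto
    have "exec P (\<lambda>_. 0, w) (?s, [])"
      unfolding P_def
      by (rule exec.Seq[OF s(1) exec.Seq[OF exec_Assign exec_clear]])
        (use s(2) in \<open>simp_all add: fun_upd_def\<close>)
    moreover have "out ?s = x"
      using out_eq[of 1 ?s] zero p(2) by simp
    ultimately show ?thesis
      unfolding IMP2_eq_Some_iff imp2_result_def n[symmetric] by blast
  qed
  then show thesis by (rule that)
qed

section \<open>Complexities as lengths of programs\<close>

lemma complexity_le: "U p = Some x \<Longrightarrow> complexity U x \<le> enat (length p)"
  unfolding complexity_def by (rule INF_lower) simp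

text \<open>On a nonempty set the infimum in \<open>enat\<close> is a least element, so a finite
  complexity is the length of an actual program.\<close>

lemma complexity_attained:
  assumes "complexity U x \<noteq> \<infinity>"
  obtains p where "U p = Some x" "complexity U x = enat (length p)"
proof -
  have "Inf A \<in> A" if "Inf A \<noteq> \<infinity>" for A :: "enat set"
    using that unfolding Inf_enat_def by (auto split: if_splits intro: LeastI)
  from this[OF assms[unfolded complexity_def]] that show thesis
    unfolding complexity_def by auto
qed

theorem proposition1: "additively_optimal prefix_machine IMP2"
  unfolding additively_optimal_def
proof (intro conjI allI impI)
  show "prefix_machine IMP2"
    unfolding prefix_machine_def using partial_computable_IMP2 prefix_free_dom_IMP2 by blast
next
  fix G
  assume "prefix_machine G"
  then obtain n where n: "\<And>p x. G p = Some x \<Longrightarrow> IMP2 (tuple n p) = Some x"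
    by (rule prefix_machine_simulation) blast
  \<comment> \<open>The price of the simulation is the header that \<open>tuple n p\<close> puts in
    front of \<open>p\<close>.\<close>
  have "complexity IMP2 x \<le> complexity G x + enat (length (selfdelim n))" for x
  proof (cases "complexity G x = \<infinity>")
    case False
    then obtain p where "G p = Some x" and p: "complexity G x = enat (length p)"
      by (rule complexity_attained)
    from complexity_le[of IMP2, OF n, OF this(1)] show ?thesis
      by (simp add: p tuple_def add.commute)
  qed simp
  then show "\<exists>c. \<forall>x. complexity IMP2 x \<le> complexity G x + enat c" by blast
qed

end
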